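(* Fix an integer $k\ge3$. For $n\ge1$ let $S_k$ act on $[k]^n$ by $(g\cdot x)_i=g(x_i)$, let $K_n$ be the classical Burnside kernel on $[k]^n$, $Q_n$ the dual Burnside kernel on $S_k^*$, and $\bar Q_n^{\mathrm{fs}}$ the lumping of $Q_n$ by the fixed-symbol-set blocks $E_S$, $S\in\mathcal B_k$. As $n\to\infty$, for all $S,T\in\mathcal B_k$, $$\bar Q_n^{\mathrm{fs}}(S,T)\longrightarrow\bar Q_\infty^{\mathrm{fs}}(S,T):=\frac{{!}(k-|T|)}{(k-|S|)!}\mathbf 1_{\{S\subseteq T\}}.$$ Ordering $\mathcal B_k$ so that $S$ appears before $T$ whenever $S\subsetneq T$, the limit is upper triangular with diagonal entries $$\theta_{k,|S|}:=\frac{{!}(k-|S|)}{(k-|S|)!}.$$ Thus the eigenvalues of $\bar Q_n^{\mathrm{fs}}$, counted with multiplicity, converge: $$\mathrm{Spec}(\bar Q_n^{\mathrm{fs}})\to\left\{\theta_{k,r}\text{ with multiplicity }\binom kr:\ r\in\{1,\dots,k-2,k\}\right\}.$$ Since the limiting eigenvalues are nonzero, $\bar Q_n^{\mathrm{fs}}$ is nonsingular for all large $n$. Consequently, $$\lambda_1(K_n)=\lambda_1(Q_n)\to\frac12,\qquad t_{\mathrm{rel}}(K_n)=t_{\mathrm{rel}}(Q_n)\to2.$$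
   Context: $[k]=\{1,\dots,k\}$; $\mathrm{Fix}(g)=\{a\in[k]:g(a)=a\}$; ${!}m$ is the number of derangements of $m$ symbols (${!}0=1$). For $G=S_k$ acting on $X=[k]^n$: $X_g=\{x:g\cdot x=x\}$, $G_x=\{g:g\cdot x=x\}$, $S_k^*=\{g\in S_k:\mathrm{Fix}(g)\ne\varnothing\}$, $K_n(x,y)=\frac1{|G_x|}\sum_{g\in G_x\cap G_y}\frac1{|X_g|}$ on $X$, and $Q_n(g,h)=\frac1{|X_g|}\sum_{x\in X_g\cap X_h}\frac1{|G_x|}$ on $S_k^*$; both are irreducible and reversible. $\mathcal B_k:=\{S\subseteq[k]:S\ne\varnothing,\ |S|\ne k-1\}$ and $E_S:=\{g\in S_k^*:\mathrm{Fix}(g)=S\}$. The kernel $Q_n$ is strongly lumpable with respect to the partition $\{E_S\}_{S\in\mathcal B_k}$ of $S_k^*$; the lumped kernel is $\bar Q_n^{\mathrm{fs}}(S,T)=\sum_{h\in E_T}Q_n(g,h)$ for any $g\in E_S$. For an irreducible reversible kernel $P$: $\lambda_1(P):=\max\{\lambda\in\mathrm{Spec}(P):\lambda\ne1\}$, $\lambda_*(P):=\max\{|\lambda|:\lambda\in\mathrm{Spec}(P),\lambda\ne1\}$ (both $0$ if there is no eigenvalue other than $1$), and $t_{\mathrm{rel}}(P):=(1-\lambda_*(P))^{-1}$. *)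

theory Defs
  imports
    Complex_Main
    "HOL-Algebra.Sym_Groups"
    "HOL-Algebra.Group_Action"
    "Jordan_Normal_Form.Spectral_Radius"
begin

section \<open>Spectra of kernels on finite sets\<close>

definition kernel_mat :: "('a \<Rightarrow> 'a \<Rightarrow> real) \<Rightarrow> 'a list \<Rightarrow> real mat" where
  "kernel_mat P xs = mat (length xs) (length xs) (\<lambda>(i, j). P (xs ! i) (xs ! j))"

definition enum_list :: "'a set \<Rightarrow> 'a list" where
  "enum_list X = (SOME xs. distinct xs \<and> set xs = X)"

lemma enum_list: "finite X \<Longrightarrow> distinct (enum_list X) \<and> set (enum_list X) = X"
  unfolding enum_list_def by (rule someI_ex) (metis finite_distinct_list)

definition kernel_cmat :: "('a \<Rightarrow> 'a \<Rightarrow> real) \<Rightarrow> 'a set \<Rightarrow> complex mat" where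
  "kernel_cmat P X = map_mat complex_of_real (kernel_mat P (enum_list X))"

definition Spec :: "('a \<Rightarrow> 'a \<Rightarrow> real) \<Rightarrow> 'a set \<Rightarrow> complex set" where
  "Spec P X = spectrum (kernel_cmat P X)"

definition Spec_mset :: "('a \<Rightarrow> 'a \<Rightarrow> real) \<Rightarrow> 'a set \<Rightarrow> complex multiset" where
  "Spec_mset P X = proots (char_poly (kernel_cmat P X))"

text \<open>The spectrum does not depend on the enumeration chosen by \<^const>\<open>enum_list\<close>: different
  enumerations give similar matrices.\<close>

lemma kernel_mat_similar:
  assumes "distinct xs" "distinct ys" "set xs = set ys"
  shows "similar_mat (map_mat complex_of_real (kernel_mat P xs))
                     (map_mat complex_of_real (kernel_mat P ys))"
proof -
  define n where "n = length xs"
  have n: "length ys = n" "length xs = n"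
    using assms by (auto simp: n_def) (metis distinct_card)
  define p where "p i = (THE j. j < n \<and> ys ! j = xs ! i)" for i
  have ex1: "\<exists>!j. j < n \<and> ys ! j = xs ! i" if "i < n" for i
    using that assms n by (metis distinct_Ex1 nth_mem)
  have p: "p i < n" "ys ! p i = xs ! i" if "i < n" for i
    using theI'[OF ex1[OF that]] unfolding p_def by auto
  have inj: "p i = p j \<longleftrightarrow> i = j" if "i < n" "j < n" for i j
    using p[OF that(1)] p[OF that(2)] assms(1) n that by (metis nth_eq_iff_index_eq)
  have bij: "bij_betw p {0..<n} {0..<n}"
    unfolding bij_betw_def
  proof
    show *: "inj_on p {0..<n}" using inj by (auto simp: inj_on_def)
    show "p ` {0..<n} = {0..<n}"
      by (rule endo_inj_surj) (use * p in auto)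
  qed
  let ?A = "map_mat complex_of_real (kernel_mat P xs)"
  let ?B = "map_mat complex_of_real (kernel_mat P ys)"
  let ?U = "mat n n (\<lambda>(i, j). if j = p i then 1 else 0 :: complex)"
  let ?V = "mat n n (\<lambda>(i, j). if i = p j then 1 else 0 :: complex)"
  have UV: "?U * ?V = 1\<^sub>m n"
    by (rule eq_matI) (auto simp: scalar_prod_def inj p if_distrib cong: if_cong)
  have VU: "?V * ?U = 1\<^sub>m n"
    by (rule mat_mult_left_right_inverse[OF _ _ UV]) auto
  have UB: "?U * ?B = mat n n (\<lambda>(i, j). complex_of_real (P (xs ! i) (ys ! j)))"
    by (rule eq_matI)
      (auto simp: scalar_prod_def kernel_mat_def n p if_distrib[where f = "\<lambda>x. x * _"] cong: if_cong)
  have "?U * ?B * ?V = ?A"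
    unfolding UB
    by (rule eq_matI)
      (auto simp: scalar_prod_def kernel_mat_def n p if_distrib[where f = "\<lambda>x. _ * x"] cong: if_cong)
  then show ?thesis
    unfolding similar_mat_def similar_mat_wit_def
    using UV VU by (intro exI[of _ ?U] exI[of _ ?V]) (auto simp: kernel_mat_def n Let_def)
qed

lemma Spec_enum_independent:
  assumes "distinct xs" "set xs = X"
  shows "Spec_mset P X = proots (char_poly (map_mat complex_of_real (kernel_mat P xs)))"
    and "Spec P X = spectrum (map_mat complex_of_real (kernel_mat P xs))"
proof -
  let ?B = "map_mat complex_of_real (kernel_mat P xs)"
  let ?A = "map_mat complex_of_real (kernel_mat P (enum_list X))"
  have *: "char_poly ?A = char_poly ?B"
    using enum_list[of X] assms by (intro char_poly_similar kernel_mat_similar) auto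
  then show "Spec_mset P X = proots (char_poly ?B)"
    by (simp add: Spec_mset_def kernel_cmat_def)
  have "spectrum ?A = {x. poly (char_poly ?A) x = 0}"
    by (rule spectrum_root_char_poly) (auto simp: kernel_mat_def)
  also have "\<dots> = spectrum ?B"
    unfolding * by (rule spectrum_root_char_poly[symmetric]) (auto simp: kernel_mat_def)
  finally show "Spec P X = spectrum ?B"
    by (simp add: Spec_def kernel_cmat_def)
qed

text \<open>These quantities are used for irreducible reversible kernels, whose eigenvalues are all real;
  restricting the first maximum to real eigenvalues is therefore no restriction.\<close>

definition lambda1 :: "('a \<Rightarrow> 'a \<Rightarrow> real) \<Rightarrow> 'a set \<Rightarrow> real" where
  "lambda1 P X =
    (let L = {r. complex_of_real r \<in> Spec P X \<and> r \<noteq> 1} in if L = {} then 0 else Max L)"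

definition lambda_star :: "('a \<Rightarrow> 'a \<Rightarrow> real) \<Rightarrow> 'a set \<Rightarrow> real" where
  "lambda_star P X = (let L = cmod ` (Spec P X - {1}) in if L = {} then 0 else Max L)"

definition t_rel :: "('a \<Rightarrow> 'a \<Rightarrow> real) \<Rightarrow> 'a set \<Rightarrow> real" where
  "t_rel P X = inverse (1 - lambda_star P X)"

text \<open>Convergence of finite multisets: for every \<open>\<epsilon>\<close>, eventually the two multisets have the same
  size and can be matched so that matched elements are at distance less than \<open>\<epsilon>\<close>.\<close>

definition mset_tendsto ::
    "('b \<Rightarrow> 'a :: metric_space multiset) \<Rightarrow> 'a multiset \<Rightarrow> 'b filter \<Rightarrow> bool" where
  "mset_tendsto M L F \<longleftrightarrow> (\<forall>\<epsilon>>0. \<forall>\<^sub>F n in F. rel_mset (\<lambda>x y. dist x y < \<epsilon>) (M n) L)"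

section \<open>Burnside kernels of a group action and lumpings\<close>

definition burnside_kernel ::
    "('g, 'm) monoid_scheme \<Rightarrow> 'x set \<Rightarrow> ('g \<Rightarrow> 'x \<Rightarrow> 'x) \<Rightarrow> 'x \<Rightarrow> 'x \<Rightarrow> real" where
  "burnside_kernel G X \<phi> x y =
     1 / card (stabilizer G \<phi> x) *
     (\<Sum>g \<in> stabilizer G \<phi> x \<inter> stabilizer G \<phi> y. 1 / card (invariants X \<phi> g))"

definition dual_burnside_kernel ::
    "('g, 'm) monoid_scheme \<Rightarrow> 'x set \<Rightarrow> ('g \<Rightarrow> 'x \<Rightarrow> 'x) \<Rightarrow> 'g \<Rightarrow> 'g \<Rightarrow> real" where
  "dual_burnside_kernel G X \<phi> g h =
     1 / card (invariants X \<phi> g) *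
     (\<Sum>x \<in> invariants X \<phi> g \<inter> invariants X \<phi> h. 1 / card (stabilizer G \<phi> x))"

text \<open>Only meaningful for a kernel that is strongly lumpable with respect to the blocks
  \<open>E S\<close>; then the choice of \<open>g\<close> is immaterial.\<close>

definition lumped_kernel :: "('g \<Rightarrow> 'g \<Rightarrow> real) \<Rightarrow> ('s \<Rightarrow> 'g set) \<Rightarrow> 's \<Rightarrow> 's \<Rightarrow> real" where
  "lumped_kernel P E S T = (\<Sum>h \<in> E T. P (SOME g. g \<in> E S) h)"

section \<open>The symmetric group acting on words\<close>

definition words :: "nat \<Rightarrow> nat \<Rightarrow> (nat \<Rightarrow> nat) set" where
  "words k n = {1..n} \<rightarrow>\<^sub>E {1..k}"

definition word_action :: "nat \<Rightarrow> nat \<Rightarrow> (nat \<Rightarrow> nat) \<Rightarrow> (nat \<Rightarrow> nat) \<Rightarrow> (nat \<Rightarrow> nat)" where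
  "word_action k n g = (\<lambda>x \<in> words k n. \<lambda>i \<in> {1..n}. g (x i))"

definition Fix :: "nat \<Rightarrow> (nat \<Rightarrow> nat) \<Rightarrow> nat set" where
  "Fix k g = {a \<in> {1..k}. g a = a}"

definition sym_star :: "nat \<Rightarrow> (nat \<Rightarrow> nat) set" where
  "sym_star k = {g \<in> carrier (sym_group k). Fix k g \<noteq> {}}"

definition K_kernel :: "nat \<Rightarrow> nat \<Rightarrow> (nat \<Rightarrow> nat) \<Rightarrow> (nat \<Rightarrow> nat) \<Rightarrow> real" where
  "K_kernel k n = burnside_kernel (sym_group k) (words k n) (word_action k n)"

definition Q_kernel :: "nat \<Rightarrow> nat \<Rightarrow> (nat \<Rightarrow> nat) \<Rightarrow> (nat \<Rightarrow> nat) \<Rightarrow> real" where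
  "Q_kernel k n = dual_burnside_kernel (sym_group k) (words k n) (word_action k n)"

definition fs_index :: "nat \<Rightarrow> nat set set" where
  "fs_index k = {S. S \<subseteq> {1..k} \<and> S \<noteq> {} \<and> card S \<noteq> k - 1}"

definition fs_block :: "nat \<Rightarrow> nat set \<Rightarrow> (nat \<Rightarrow> nat) set" where
  "fs_block k S = {g \<in> sym_star k. Fix k g = S}"

definition Q_fs :: "nat \<Rightarrow> nat \<Rightarrow> nat set \<Rightarrow> nat set \<Rightarrow> real" where
  "Q_fs k n = lumped_kernel (Q_kernel k n) (fs_block k)"

definition derangements :: "nat \<Rightarrow> nat" where
  "derangements m = card {p. p permutes {1..m} \<and> (\<forall>i \<in> {1..m}. p i \<noteq> i)}"

definition Q_fs_limit :: "nat \<Rightarrow> nat set \<Rightarrow> nat set \<Rightarrow> real" where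
  "Q_fs_limit k S T =
     real (derangements (k - card T)) / fact (k - card S) * of_bool (S \<subseteq> T)"

definition theta :: "nat \<Rightarrow> nat \<Rightarrow> real" where
  "theta k r = real (derangements (k - r)) / fact (k - r)"

definition inclusion_ordering :: "nat \<Rightarrow> nat set list \<Rightarrow> bool" where
  "inclusion_ordering k Ss \<longleftrightarrow> distinct Ss \<and> set Ss = fs_index k \<and>
     (\<forall>i < length Ss. \<forall>j < length Ss. Ss ! i \<subset> Ss ! j \<longrightarrow> i < j)"

lemma word_action_group_action: "group_action (sym_group k) (words k n) (word_action k n)"
proof -
  have clos: "word_action k n g x \<in> words k n" if "g permutes {1..k}" "x \<in> words k n" for g x
    using that permutes_in_image[OF that(1)] unfolding word_action_def words_def by (auto simp: PiE_iff)
  have comp: "word_action k n (g \<circ> h) x = word_action k n g (word_action k n h x)"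
    if "g permutes {1..k}" "h permutes {1..k}" "x \<in> words k n" for g h x
    using clos[OF that(2,3)] that by (auto simp: word_action_def)
  have one: "word_action k n id x = x" if "x \<in> words k n" for x
    using that by (auto simp: word_action_def words_def PiE_iff extensional_def fun_eq_iff)
  have Bij: "word_action k n g \<in> Bij (words k n)" if g: "g permutes {1..k}" for g
  proof -
    have i: "Hilbert_Choice.inv g permutes {1..k}" using g by (rule permutes_inv)
    have "bij_betw (word_action k n g) (words k n) (words k n)"
      by (rule bij_betw_byWitness[where f' = "word_action k n (Hilbert_Choice.inv g)"])
        (use g i clos comp[OF g i] comp[OF i g] one permutes_inv_o[OF g] in auto)
    then show ?thesis by (simp add: Bij_def word_action_def)
  qed
  have "group_hom (sym_group k) (BijGroup (words k n)) (word_action k n)"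
    unfolding group_hom_def group_hom_axioms_def
  proof (intro conjI sym_group_is_group group_BijGroup homI)
    fix g h assume gh: "g \<in> carrier (sym_group k)" "h \<in> carrier (sym_group k)"
    then have gh': "g permutes {1..k}" "h permutes {1..k}" by (auto simp: sym_group_def)
    show "word_action k n (g \<otimes>\<^bsub>sym_group k\<^esub> h) =
        word_action k n g \<otimes>\<^bsub>BijGroup (words k n)\<^esub> word_action k n h"
      using Bij[OF gh'(1)] Bij[OF gh'(2)] comp[OF gh']
      by (auto simp: sym_group_def BijGroup_def compose_def fun_eq_iff word_action_def)
  qed (auto simp: BijGroup_def sym_group_def Bij)
  then show ?thesis by (simp add: group_action_def)
qed

lemma invariants_word_action:
  "invariants (words k n) (word_action k n) g =
     {x \<in> words k n. \<forall>i \<in> {1..n}. x i \<in> Fix k g}"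
proof -
  have "word_action k n g x = x \<longleftrightarrow> (\<forall>i \<in> {1..n}. x i \<in> Fix k g)" if x: "x \<in> words k n" for x
  proof -
    have x': "x \<in> extensional {1..n}" "\<And>i. i \<in> {1..n} \<Longrightarrow> x i \<in> {1..k}"
      using x unfolding words_def by (simp_all only: PiE_iff)
    have "word_action k n g x = x \<longleftrightarrow> (\<forall>i \<in> {1..n}. g (x i) = x i)"
      using x x'(1) extensionalityI[of "restrict (\<lambda>i. g (x i)) {1..n}" "{1..n}" x]
      unfolding word_action_def by (metis restrict_apply' restrict_extensional)
    then show ?thesis using x'(2) unfolding Fix_def by blast
  qed
  then show ?thesis unfolding invariants_def by blast
qed

text \<open>Strong lumpability: the lumped kernel may be computed from any representative.\<close>

lemma Q_fs_eq:
  assumes "g \<in> fs_block k S"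
  shows "Q_fs k n S T = (\<Sum>h \<in> fs_block k T. Q_kernel k n g h)"
proof -
  define g' where "g' = (SOME g. g \<in> fs_block k S)"
  have "g' \<in> fs_block k S"
    unfolding g'_def by (rule someI[of "\<lambda>g. g \<in> fs_block k S", OF assms])
  then have Fix: "Fix k g' = Fix k g"
    using assms by (simp add: fs_block_def)
  have "Q_kernel k n g' h = Q_kernel k n g h" for h
    unfolding Q_kernel_def dual_burnside_kernel_def invariants_word_action Fix ..
  then show ?thesis
    unfolding Q_fs_def lumped_kernel_def g'_def[symmetric] by simp
qed

lemma inclusion_ordering_exists: "\<exists>Ss. inclusion_ordering k Ss"
proof -
  have "fs_index k \<subseteq> Pow {1..k}" by (auto simp: fs_index_def)
  then have fin: "finite (fs_index k)" by (rule finite_subset) simp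
  define Ss where "Ss = sort_key card (enum_list (fs_index k))"
  have *: "distinct Ss" "set Ss = fs_index k" "sorted (map card Ss)"
    using enum_list[OF fin] unfolding Ss_def by simp_all
  have "i < j" if ij: "i < length Ss" "j < length Ss" "Ss ! i \<subset> Ss ! j" for i j
  proof (rule ccontr)
    assume "\<not> i < j"
    then have "map card Ss ! j \<le> map card Ss ! i"
      by (intro sorted_nth_mono[OF *(3)]) (use ij in simp_all)
    then have le: "card (Ss ! j) \<le> card (Ss ! i)"
      using ij(1,2) by simp
    have "Ss ! j \<subseteq> {1..k}"
      using nth_mem[OF ij(2)] unfolding *(2) fs_index_def by blast
    then have "finite (Ss ! j)" by (rule finite_subset) simp
    from psubset_card_mono[OF this ij(3)] le show False by simp
  qed
  with * have "inclusion_ordering k Ss" unfolding inclusion_ordering_def by simp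
  then show ?thesis ..
qed

end

theory Submission
  imports Defs
begin

text \<open>Both Burnside kernels factor through the incidence relation between words and permutations,
  and \<open>Q\<^sub>n\<close> factors through its lumping, so by \<open>Spec(AB) - {0} = Spec(BA) - {0}\<close> all three kernels have
  the same nonzero spectrum; it is nonnegative because \<open>Q\<^sub>n\<close> is a rescaled Gram matrix. A random word
  over \<open>S\<close> uses every letter of \<open>S\<close> with probability tending to \<open>1\<close>, which gives the entrywise limit of
  the lumping. Continuity of polynomial roots then turns this into convergence of the spectra. The
  bound \<open>2 !m \<le> m!\<close> for \<open>m \<ge> 1\<close>, an equality for \<open>m = 2\<close>, shows that the second largest limit
  eigenvalue is \<open>1/2\<close>; stochasticity keeps the eigenvalue \<open>1\<close> of the kernels fixed along the way.\<close>

text \<open>The matrices of \<open>K_kernel\<close> have size k^n and so have no limit. Only the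
  lumped kernel lives on an index set independent of n, and the spectral quantities are transported
  there before n tends to infinity. The transport sees nonzero eigenvalues only; this suffices
  because \<open>lambda_star\<close> is a maximum of moduli with default value 0. Nonnegativity
  identifies \<open>lambda1\<close> with \<open>lambda_star\<close>, so one limit serves both the
  second eigenvalue and the relaxation time. The delicate point is that \<open>lambda_star\<close>
  discards the exact value 1 and is therefore not continuous in the spectrum: an eigenvalue near 1
  but different from it would count. Two facts exclude this: the limit eigenvalue 1 has multiplicity
  binom(k,k) = 1, and for n >= 1 the number 1 itself is an eigenvalue, so it uses up that single
  place. The value 1/2 belongs to the sets S of size k - 2: of the two permutations of the remaining
  two symbols, one is a derangement. For k >= 3 such S are nonempty.\<close>

section \<open>Spectra of kernels\<close>

text \<open>Eigenvectors as functions on the state space: finite sums replace matrix products and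
  the enumeration disappears. Values of \<open>v\<close> outside \<open>X\<close> carry no
  information, so nonvanishing is demanded on \<open>X\<close>.\<close>

definition kernel_eigenfun :: "('a \<Rightarrow> 'a \<Rightarrow> real) \<Rightarrow> 'a set \<Rightarrow> complex \<Rightarrow> ('a \<Rightarrow> complex) \<Rightarrow> bool" where
  "kernel_eigenfun P X c v \<longleftrightarrow> (\<exists>x\<in>X. v x \<noteq> 0) \<and>
     (\<forall>x\<in>X. (\<Sum>y\<in>X. complex_of_real (P x y) * v y) = c * v x)"

lemma kernel_cmat_carrier: "kernel_cmat P X \<in> carrier_mat (length (enum_list X)) (length (enum_list X))"
  by (simp add: kernel_cmat_def kernel_mat_def)

lemma Spec_iff_eigenfun:
  assumes "finite X"
  shows "c \<in> Spec P X \<longleftrightarrow> (\<exists>v. kernel_eigenfun P X c v)"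
proof -
  define xs where "xs = enum_list X"
  define N where "N = length xs"
  have xs: "distinct xs" "set xs = X"
    using enum_list[OF assms] by (auto simp: xs_def)
  have bij: "bij_betw ((!) xs) {0..<N} X"
    using bij_betw_nth[OF xs(1), of "{0..<N}" X] xs(2) by (auto simp: N_def atLeast0LessThan)
  let ?A = "kernel_cmat P X"
  have A: "?A \<in> carrier_mat N N"
    using kernel_cmat_carrier by (auto simp: N_def xs_def)
  have mult: "(?A *\<^sub>v w) $ i = (\<Sum>y\<in>X. complex_of_real (P (xs ! i) y) * v y)"
    if w: "w \<in> carrier_vec N" "\<And>j. j < N \<Longrightarrow> w $ j = v (xs ! j)" and i: "i < N" for w v i
  proof -
    have "(?A *\<^sub>v w) $ i = (\<Sum>j\<in>{0..<N}. complex_of_real (P (xs ! i) (xs ! j)) * v (xs ! j))"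
      using w i A by (auto simp: scalar_prod_def kernel_cmat_def kernel_mat_def xs_def N_def
          intro!: sum.cong)
    also have "\<dots> = (\<Sum>y\<in>X. complex_of_real (P (xs ! i) y) * v y)"
      by (rule sum.reindex_bij_betw[OF bij])
    finally show ?thesis .
  qed
  have Spec: "c \<in> Spec P X \<longleftrightarrow> (\<exists>w. w \<in> carrier_vec N \<and> w \<noteq> 0\<^sub>v N \<and> ?A *\<^sub>v w = c \<cdot>\<^sub>v w)"
    using A by (auto simp: Spec_def spectrum_def eigenvalue_def eigenvector_def)
  \<comment> \<open>Stated for any \<open>w\<close> and \<open>v\<close> that agree along the
    enumeration, so that it serves both directions.\<close>
  have iff: "w \<in> carrier_vec N \<and> w \<noteq> 0\<^sub>v N \<and> ?A *\<^sub>v w = c \<cdot>\<^sub>v w \<longleftrightarrow> kernel_eigenfun P X c v"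
    if w: "w \<in> carrier_vec N" "\<And>j. j < N \<Longrightarrow> w $ j = v (xs ! j)" for w v
  proof -
    have all: "(\<forall>x\<in>X. R x) \<longleftrightarrow> (\<forall>i<N. R (xs ! i))" for R
      using xs(2) by (metis in_set_conv_nth N_def)
    have "w \<noteq> 0\<^sub>v N \<longleftrightarrow> (\<exists>x\<in>X. v x \<noteq> 0)"
      using all[of "\<lambda>x. v x = 0"] w by (auto simp: vec_eq_iff)
    moreover have "?A *\<^sub>v w = c \<cdot>\<^sub>v w \<longleftrightarrow>
        (\<forall>x\<in>X. (\<Sum>y\<in>X. complex_of_real (P x y) * v y) = c * v x)"
    proof -
      have "?A *\<^sub>v w = c \<cdot>\<^sub>v w \<longleftrightarrow> (\<forall>i<N. (?A *\<^sub>v w) $ i = (c \<cdot>\<^sub>v w) $ i)"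
        using A w(1) by (auto simp: vec_eq_iff)
      also have "\<dots> \<longleftrightarrow> (\<forall>i<N. (\<Sum>y\<in>X. complex_of_real (P (xs ! i) y) * v y) = c * v (xs ! i))"
        using mult[OF w] w by auto
      finally show ?thesis using all by auto
    qed
    ultimately show ?thesis using w(1) by (simp add: kernel_eigenfun_def)
  qed
  show ?thesis
  proof
    assume "c \<in> Spec P X"
    then obtain w where w: "w \<in> carrier_vec N" "w \<noteq> 0\<^sub>v N" "?A *\<^sub>v w = c \<cdot>\<^sub>v w"
      using Spec by auto
    have "w $ j = w $ inv_into {0..<N} ((!) xs) (xs ! j)" if "j < N" for j
      using bij_betw_inv_into_left[OF bij, of j] that by simp
    then show "\<exists>v. kernel_eigenfun P X c v"
      using iff[OF w(1), of "\<lambda>x. w $ inv_into {0..<N} ((!) xs) x"] w by blast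
  next
    assume "\<exists>v. kernel_eigenfun P X c v"
    then obtain v where "kernel_eigenfun P X c v" ..
    then show "c \<in> Spec P X"
      using iff[of "vec N (\<lambda>j. v (xs ! j))" v] unfolding Spec by (intro exI[of _ "vec N (\<lambda>j. v (xs ! j))"]) simp
  qed
qed

lemma finite_Spec: "finite (Spec P X)"
  unfolding Spec_def by (rule card_finite_spectrum[OF kernel_cmat_carrier])

lemma Spec_cong:
  assumes "finite X" "\<And>x y. x \<in> X \<Longrightarrow> y \<in> X \<Longrightarrow> P x y = P' x y"
  shows "Spec P X = Spec P' X"
  using assms by (auto simp: Spec_iff_eigenfun kernel_eigenfun_def)

text \<open>If A B v = c v, then w = B v satisfies B A w = c w. It does not vanish, because A w = c
  v and c is nonzero. \<open>A\<close> and \<open>B\<close> may be rectangular.\<close>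

lemma Spec_comp_subset:
  assumes "finite X" "finite Y" "c \<noteq> 0" "c \<in> Spec (\<lambda>x x'. \<Sum>y\<in>Y. A x y * B y x') X"
  shows "c \<in> Spec (\<lambda>y y'. \<Sum>x\<in>X. B y x * A x y') Y"
proof -
  obtain v where "kernel_eigenfun (\<lambda>x x'. \<Sum>y\<in>Y. A x y * B y x') X c v"
    using assms(4) unfolding Spec_iff_eigenfun[OF assms(1)] by blast
  then have nz: "\<exists>x\<in>X. v x \<noteq> 0"
    and ev: "\<And>x. x \<in> X \<Longrightarrow> (\<Sum>x'\<in>X. complex_of_real (\<Sum>y\<in>Y. A x y * B y x') * v x') = c * v x"
    by (auto simp: kernel_eigenfun_def)
  define w where "w y = (\<Sum>x\<in>X. complex_of_real (B y x) * v x)" for y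
  have Aw: "(\<Sum>y\<in>Y. complex_of_real (A x y) * w y) = c * v x" if "x \<in> X" for x
  proof -
    have "(\<Sum>y\<in>Y. complex_of_real (A x y) * w y) =
        (\<Sum>y\<in>Y. \<Sum>x'\<in>X. complex_of_real (A x y) * complex_of_real (B y x') * v x')"
      by (simp add: w_def sum_distrib_left mult.assoc)
    also have "\<dots> = (\<Sum>x'\<in>X. \<Sum>y\<in>Y. complex_of_real (A x y) * complex_of_real (B y x') * v x')"
      by (rule sum.swap)
    also have "\<dots> = c * v x"
      using ev[OF that] by (simp add: sum_distrib_right)
    finally show ?thesis .
  qed
  have "(\<Sum>y'\<in>Y. complex_of_real (\<Sum>x\<in>X. B y x * A x y') * w y') = c * w y" for y
  proof -
    have "(\<Sum>y'\<in>Y. complex_of_real (\<Sum>x\<in>X. B y x * A x y') * w y') =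
        (\<Sum>y'\<in>Y. \<Sum>x\<in>X. complex_of_real (B y x) * (complex_of_real (A x y') * w y'))"
      by (simp add: sum_distrib_right mult.assoc)
    also have "\<dots> = (\<Sum>x\<in>X. \<Sum>y'\<in>Y. complex_of_real (B y x) * (complex_of_real (A x y') * w y'))"
      by (rule sum.swap)
    also have "\<dots> = (\<Sum>x\<in>X. complex_of_real (B y x) * (c * v x))"
      by (simp add: sum_distrib_left[symmetric] Aw)
    also have "\<dots> = c * w y"
      by (simp add: w_def sum_distrib_left mult.left_commute)
    finally show ?thesis .
  qed
  moreover have "\<exists>y\<in>Y. w y \<noteq> 0"
  proof (rule ccontr)
    assume "\<not> ?thesis"
    then have "c * v x = 0" if "x \<in> X" for x using Aw[OF that] by simp
    then show False using nz assms(3) by auto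
  qed
  ultimately have "kernel_eigenfun (\<lambda>y y'. \<Sum>x\<in>X. B y x * A x y') Y c w"
    by (simp add: kernel_eigenfun_def)
  then show ?thesis unfolding Spec_iff_eigenfun[OF assms(2)] by blast
qed

lemma Spec_comp_commute:
  assumes "finite X" "finite Y"
  shows "Spec (\<lambda>x x'. \<Sum>y\<in>Y. A x y * B y x') X - {0} = Spec (\<lambda>y y'. \<Sum>x\<in>X. B y x * A x y') Y - {0}"
  using Spec_comp_subset[OF assms] Spec_comp_subset[OF assms(2,1)] by blast

text \<open>A Rayleigh quotient: pairing the eigenvalue equation with v under the weight
  \<open>W\<close> gives c * s = t, where s > 0 is the weighted square norm of v and t >= 0 that of
  C v under \<open>D\<close>. Reality and nonnegativity of c come out together.\<close>

lemma Spec_gram_nonneg: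
  fixes W :: "'a \<Rightarrow> real" and D :: "'b \<Rightarrow> real" and C :: "'b \<Rightarrow> 'a \<Rightarrow> real"
  assumes "finite X" "finite Y" and W: "\<And>x. x \<in> X \<Longrightarrow> W x > 0" and D: "\<And>y. y \<in> Y \<Longrightarrow> D y \<ge> 0"
    and P: "\<And>x x'. x \<in> X \<Longrightarrow> x' \<in> X \<Longrightarrow> W x * P x x' = (\<Sum>y\<in>Y. D y * C y x * C y x')"
    and c: "c \<in> Spec P X"
  shows "\<exists>r\<ge>0. c = complex_of_real r"
proof -
  obtain v where "kernel_eigenfun P X c v"
    using c unfolding Spec_iff_eigenfun[OF assms(1)] by blast
  then obtain x0 where x0: "x0 \<in> X" "v x0 \<noteq> 0"
    and ev: "\<And>x. x \<in> X \<Longrightarrow> (\<Sum>x'\<in>X. complex_of_real (P x x') * v x') = c * v x"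
    by (auto simp: kernel_eigenfun_def)
  define s where "s = (\<Sum>x\<in>X. W x * (cmod (v x))\<^sup>2)"
  define u where "u y = (\<Sum>x\<in>X. complex_of_real (C y x) * v x)" for y
  define t where "t = (\<Sum>y\<in>Y. D y * (cmod (u y))\<^sup>2)"
  have s: "s > 0"
    unfolding s_def by (rule sum_pos2[of _ x0]) (use x0 W assms(1) in \<open>auto simp: less_imp_le\<close>)
  have t: "t \<ge> 0" unfolding t_def by (intro sum_nonneg mult_nonneg_nonneg) (auto simp: D)
  have "complex_of_real t = (\<Sum>y\<in>Y. D y * (cnj (u y) * u y))"
    by (simp add: t_def complex_norm_square[symmetric] mult.commute[of "cnj _"])
  also have "\<dots> = (\<Sum>y\<in>Y. \<Sum>x\<in>X. \<Sum>x'\<in>X. complex_of_real (D y * C y x * C y x') * (cnj (v x) * v x'))"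
    by (simp add: u_def sum_product sum_distrib_left mult_ac)
  also have "\<dots> = (\<Sum>x\<in>X. \<Sum>y\<in>Y. \<Sum>x'\<in>X. complex_of_real (D y * C y x * C y x') * (cnj (v x) * v x'))"
    by (rule sum.swap)
  also have "\<dots> = (\<Sum>x\<in>X. \<Sum>x'\<in>X. \<Sum>y\<in>Y. complex_of_real (D y * C y x * C y x') * (cnj (v x) * v x'))"
    by (rule sum.cong[OF refl], rule sum.swap)
  also have "\<dots> = (\<Sum>x\<in>X. \<Sum>x'\<in>X. complex_of_real (W x * P x x') * (cnj (v x) * v x'))"
    by (intro sum.cong refl) (simp only: P sum_distrib_right[symmetric] of_real_sum)
  also have "\<dots> = (\<Sum>x\<in>X. W x * cnj (v x) * (\<Sum>x'\<in>X. complex_of_real (P x x') * v x'))"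
    by (simp add: sum_distrib_left mult_ac)
  also have "\<dots> = (\<Sum>x\<in>X. c * complex_of_real (W x * (cmod (v x))\<^sup>2))"
    by (intro sum.cong refl) (simp add: ev, simp add: mult_ac flip: complex_norm_square)
  also have "\<dots> = c * complex_of_real s"
    by (simp add: s_def sum_distrib_left)
  finally have "c = complex_of_real (t / s)" using s by (simp add: field_simps)
  then show ?thesis using s t by (intro exI[of _ "t / s"]) auto
qed

text \<open>Inserting 0 absorbs the default for an empty set and leaves other maxima of moduli
  unchanged; it also makes an eigenvalue 0 invisible.\<close>

lemma lambda_star_eq_Max: "lambda_star P X = Max (insert 0 (cmod ` (Spec P X - {1})))"
proof (cases "Spec P X - {1} = {}")
  case True
  then have "cmod ` (Spec P X - {1}) = {}" by blast
  then show ?thesis by (simp only: lambda_star_def Let_def) simp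
next
  case False
  then obtain c where "c \<in> Spec P X - {1}" by blast
  then have "cmod c \<le> Max (cmod ` (Spec P X - {1}))"
    using finite_Spec[of P X] by simp
  then have "0 \<le> Max (cmod ` (Spec P X - {1}))"
    using norm_ge_zero order.trans by blast
  then show ?thesis
    using False finite_Spec[of P X] by (simp add: lambda_star_def Let_def Max_insert max_def)
qed

lemma lambda_star_cong:
  assumes "Spec P X - {0} = Spec P' X' - {0}"
  shows "lambda_star P X = lambda_star P' X'"
proof -
  have "insert 0 (cmod ` (A - {1})) = insert 0 (cmod ` (A - {0} - {1}))" for A
    by auto
  then show ?thesis using assms unfolding lambda_star_eq_Max by metis
qed

lemma lambda1_eq_lambda_star:
  assumes "\<And>c. c \<in> Spec P X \<Longrightarrow> \<exists>r\<ge>0. c = complex_of_real r"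
  shows "lambda1 P X = lambda_star P X"
proof -
  have "{r. complex_of_real r \<in> Spec P X \<and> r \<noteq> 1} = cmod ` (Spec P X - {1})" (is "?L = ?R")
  proof
    show "?L \<subseteq> ?R"
    proof
      fix r assume "r \<in> ?L"
      then have "complex_of_real r \<in> Spec P X - {1}" "r = cmod (complex_of_real r)"
        using assms[of "complex_of_real r"] by auto
      then show "r \<in> ?R" by blast
    qed
    show "?R \<subseteq> ?L" using assms by force
  qed
  then show ?thesis by (simp add: lambda1_def lambda_star_def)
qed

section \<open>Continuity of polynomial roots and of spectra\<close>

lemma poly_eq_sum_atMost:
  fixes p :: "'a :: comm_semiring_1 poly"
  assumes "degree p \<le> d"
  shows "poly p x = (\<Sum>i\<le>d. coeff p i * x ^ i)"
  unfolding poly_altdef using assms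
  by (intro sum.mono_neutral_left) (auto simp: not_le coeff_eq_0)

lemma tendsto_coeff_mult:
  fixes p q :: "'b \<Rightarrow> 'a :: {comm_semiring_1, topological_semigroup_mult, topological_comm_monoid_add} poly"
  assumes "\<And>i. ((\<lambda>n. coeff (p n) i) \<longlongrightarrow> coeff p' i) F" "\<And>i. ((\<lambda>n. coeff (q n) i) \<longlongrightarrow> coeff q' i) F"
  shows "((\<lambda>n. coeff (p n * q n) i) \<longlongrightarrow> coeff (p' * q') i) F"
  unfolding coeff_mult by (intro tendsto_intros assms)

lemma tendsto_coeff_prod:
  fixes p :: "'c \<Rightarrow> 'b \<Rightarrow> 'a :: {comm_semiring_1, topological_semigroup_mult, topological_comm_monoid_add} poly"
  assumes "\<And>x i. x \<in> X \<Longrightarrow> ((\<lambda>n. coeff (p x n) i) \<longlongrightarrow> coeff (p' x) i) F"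
  shows "((\<lambda>n. coeff (\<Prod>x\<in>X. p x n) i) \<longlongrightarrow> coeff (\<Prod>x\<in>X. p' x) i) F"
  using assms
  by (induction X arbitrary: i rule: infinite_finite_induct) (auto intro!: tendsto_coeff_mult)

text \<open>By the Leibniz formula, each coefficient is a finite sum of products of coefficients of
  the entries of xI - A, hence continuous in A.\<close>

lemma tendsto_coeff_char_poly:
  fixes A :: "'b \<Rightarrow> complex mat"
  assumes A: "\<And>n. A n \<in> carrier_mat N N" "B \<in> carrier_mat N N"
    and lim: "\<And>i j. i < N \<Longrightarrow> j < N \<Longrightarrow> ((\<lambda>n. A n $$ (i, j)) \<longlongrightarrow> B $$ (i, j)) F"
  shows "((\<lambda>n. coeff (char_poly (A n)) m) \<longlongrightarrow> coeff (char_poly B) m) F"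
proof -
  have entry: "((\<lambda>n. coeff (char_poly_matrix (A n) $$ (i, j)) l) \<longlongrightarrow> coeff (char_poly_matrix B $$ (i, j)) l) F"
    if ij: "i < N" "j < N" for i j l
  proof -
    have *: "char_poly_matrix C $$ (i, j) = (if i = j then [:0, 1:] else 0) + [:- (C $$ (i, j)):]"
      if "C \<in> carrier_mat N N" for C :: "complex mat"
      using that ij by (auto simp: char_poly_matrix_def)
    show ?thesis
      unfolding *[OF A(1)] *[OF A(2)] coeff_add coeff_pCons
      by (intro tendsto_intros) (auto split: nat.split intro!: tendsto_intros lim ij)
  qed
  have det: "det (char_poly_matrix C) = (\<Sum>p\<in>{p. p permutes {0..<N}}.
      signof p * (\<Prod>i=0..<N. char_poly_matrix C $$ (i, p i)))"
    if "C \<in> carrier_mat N N" for C :: "complex mat"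
    using carrier_matD[OF char_poly_matrix_closed[OF that]] by (simp add: det_def)
  show ?thesis
    unfolding char_poly_def det[OF A(1)] det[OF A(2)] coeff_sum
  proof (intro tendsto_sum tendsto_coeff_mult tendsto_coeff_prod entry tendsto_const)
    fix p x assume "p \<in> {p. p permutes {0..<N}}" "x \<in> {0..<N}"
    then show "x < N" "p x < N" using permutes_in_image[of p "{0..<N}" x] by auto
  qed
qed

lemma degree_prod_mset_linear:
  "degree (\<Prod>a\<in>#M. [:- a, 1:]) = size M \<and> (\<Prod>a\<in>#M. [:- a, 1:]) \<noteq> (0 :: 'a :: idom poly)"
  by (induction M) (auto simp: degree_mult_eq simp del: mult_pCons_left)

text \<open>The root of the approximating polynomial nearest to a root \<open>a\<close> of the limit tends to \<open>a\<close>;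
  synthetic division by the corresponding linear factors is continuous in the coefficients.\<close>

lemma mset_tendsto_roots:
  fixes M :: "'b \<Rightarrow> complex multiset"
  assumes "\<And>n. size (M n) = size L"
    and "\<And>i. ((\<lambda>n. coeff (\<Prod>a\<in>#M n. [:- a, 1:]) i) \<longlongrightarrow> coeff (\<Prod>a\<in>#L. [:- a, 1:]) i) F"
  shows "mset_tendsto M L F"
  using assms
proof (induction L arbitrary: M)
  case empty
  then show ?case by (simp add: mset_tendsto_def)
next
  case (add a L)
  let ?p = "\<lambda>M :: complex multiset. \<Prod>a\<in>#M. [:- a, 1:]"
  define d where "d = size L"
  have size: "size (M n) = Suc d" for n using add.prems(1) by (simp add: d_def)
  have "\<exists>b. b \<in># M n \<and> (\<forall>c\<in>#M n. dist a b \<le> dist a c)" for n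
  proof -
    have "set_mset (M n) \<noteq> {}" using size[of n] by auto
    then show ?thesis
      using arg_min_if_finite[of "set_mset (M n)" "dist a"] by (metis finite_set_mset not_le)
  qed
  then obtain b where b: "\<And>n. b n \<in># M n" "\<And>n c. c \<in># M n \<Longrightarrow> dist a (b n) \<le> dist a c"
    by metis
  \<comment> \<open>Each factor |a - c| is at least the distance from a to the nearest root; the
    induction over submultisets multiplies these bounds.\<close>
  have bound: "dist a (b n) ^ size N \<le> norm (poly (?p N) a)" if "N \<subseteq># M n" for n N
    using that
  proof (induction N)
    case (add c N)
    then have "dist a (b n) ^ size N \<le> norm (poly (?p N) a)" "c \<in># M n"
      by (auto dest: mset_subset_eq_insertD subset_mset.less_imp_le)
    then have "dist a (b n) * dist a (b n) ^ size N \<le> norm (a - c) * norm (poly (?p N) a)"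
      using b(2)[of c n] by (intro mult_mono) (auto simp: dist_norm)
    then show ?case by (simp add: norm_mult[symmetric] algebra_simps)
  qed simp
  \<comment> \<open>All degrees equal \<open>Suc d\<close>, so the value at a is a sum over a fixed
    range and passes to the limit, which is 0 at the root a.\<close>
  have "(\<lambda>n. poly (?p (M n)) a) = (\<lambda>n. \<Sum>i\<le>Suc d. coeff (?p (M n)) i * a ^ i)"
    by (intro ext poly_eq_sum_atMost) (simp add: degree_prod_mset_linear size)
  moreover have "poly (?p (add_mset a L)) a = (\<Sum>i\<le>Suc d. coeff (?p (add_mset a L)) i * a ^ i)"
    by (intro poly_eq_sum_atMost) (simp only: degree_prod_mset_linear, simp add: d_def)
  moreover have "poly (?p (add_mset a L)) a = 0" by simp
  moreover have "((\<lambda>n. \<Sum>i\<le>Suc d. coeff (?p (M n)) i * a ^ i) \<longlongrightarrow>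
      (\<Sum>i\<le>Suc d. coeff (?p (add_mset a L)) i * a ^ i)) F"
    by (intro tendsto_intros add.prems(2))
  ultimately have "((\<lambda>n. poly (?p (M n)) a) \<longlongrightarrow> 0) F" by simp
  then have "((\<lambda>n. norm (poly (?p (M n)) a)) \<longlongrightarrow> 0) F" by (rule tendsto_norm_zero)
  moreover have "dist a (b n) ^ Suc d \<le> norm (poly (?p (M n)) a)" for n
    using bound[of "M n" n] by (simp only: size subset_mset.order_refl)
  ultimately have "((\<lambda>n. dist a (b n) ^ Suc d) \<longlongrightarrow> 0) F"
    using tendsto_sandwich[of "\<lambda>_. 0" "\<lambda>n. dist a (b n) ^ Suc d" F "\<lambda>n. norm (poly (?p (M n)) a)" 0]
    by (simp del: power_Suc)
  then have "((\<lambda>n. root (Suc d) (dist a (b n) ^ Suc d)) \<longlongrightarrow> root (Suc d) 0) F"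
    by (rule tendsto_real_root)
  moreover have "root (Suc d) (dist a (b n) ^ Suc d) = dist a (b n)" for n
    by (rule real_root_power_cancel) auto
  ultimately have "((\<lambda>n. dist a (b n)) \<longlongrightarrow> 0) F"
    by (simp only: real_root_zero)
  then have "((\<lambda>n. dist (b n) a) \<longlongrightarrow> 0) F"
    by (simp only: dist_commute)
  then have b_lim: "(b \<longlongrightarrow> a) F" by (rule tendsto_dist_iff[THEN iffD2])
  define M' where "M' n = M n - {#b n#}" for n
  have M: "M n = add_mset (b n) (M' n)" for n using b(1) by (simp add: M'_def)
  have size': "size (M' n) = size L" for n using size[of n] by (simp add: M d_def)
  have coeff: "coeff (?p (add_mset c N)) (Suc i) = coeff (?p N) i - c * coeff (?p N) (Suc i)" for c N i
    by simp
  have "((\<lambda>n. coeff (?p (M' n)) i) \<longlongrightarrow> coeff (?p L) i) F" for i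
  \<comment> \<open>Synthetic division computes coefficient i of the quotient from coefficient i +
    1, so the induction descends from the indices above d, where both quotients have coefficient
    0.\<close>
  proof (induction "Suc d - i" arbitrary: i)
    case 0
    have "coeff (?p N) i = 0" if "size N = d" for N
      by (rule coeff_eq_0) (use 0 that degree_prod_mset_linear[of N] in simp)
    then have "coeff (?p (M' n)) i = 0" "coeff (?p L) i = 0" for n
      using size' by (simp_all add: d_def)
    then show ?case by simp
  next
    case (Suc m)
    then have "m = Suc d - Suc i" by simp
    then have IH: "((\<lambda>n. coeff (?p (M' n)) (Suc i)) \<longlongrightarrow> coeff (?p L) (Suc i)) F"
      by (rule Suc.hyps(1))
    have eq: "coeff (?p N) i = coeff (?p (add_mset c N)) (Suc i) + c * coeff (?p N) (Suc i)" for c N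
      unfolding coeff by simp
    have "((\<lambda>n. coeff (?p (M n)) (Suc i) + b n * coeff (?p (M' n)) (Suc i)) \<longlongrightarrow>
        coeff (?p (add_mset a L)) (Suc i) + a * coeff (?p L) (Suc i)) F"
      by (intro tendsto_intros IH b_lim add.prems(2))
    then show ?case unfolding M eq[symmetric] .
  qed
  then have IH: "mset_tendsto M' L F" by (intro add.IH size')
  show ?case
    unfolding mset_tendsto_def
  proof (intro allI impI)
    fix e :: real assume "e > 0"
    then have "\<forall>\<^sub>F n in F. rel_mset (\<lambda>x y. dist x y < e) (M' n) L" "\<forall>\<^sub>F n in F. dist (b n) a < e"
      using IH b_lim by (auto simp: mset_tendsto_def tendsto_iff)
    then show "\<forall>\<^sub>F n in F. rel_mset (\<lambda>x y. dist x y < e) (M n) (add_mset a L)"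
      unfolding M by eventually_elim (rule rel_mset_Plus)
  qed
qed

lemma proots_prod_linear: "proots (\<Prod>a\<leftarrow>as. [:- a, 1:]) = mset (as :: 'a :: idom list)"
proof (induction as)
  case (Cons a as)
  have "(\<Prod>a\<leftarrow>as. [:- a, 1:]) \<noteq> 0" by (auto simp: prod_list_zero_iff)
  then have "proots ([:- a, 1:] * (\<Prod>a\<leftarrow>as. [:- a, 1:])) = add_mset a (mset as)"
    by (subst proots_mult) (use Cons in simp_all)
  then show ?case by (simp del: mult_pCons_left)
qed simp

lemma prod_mset_proots_char_poly:
  fixes A :: "complex mat"
  assumes "A \<in> carrier_mat N N"
  shows "(\<Prod>a\<in>#proots (char_poly A). [:- a, 1:]) = char_poly A" "size (proots (char_poly A)) = N"
proof -
  obtain as where as: "char_poly A = (\<Prod>a\<leftarrow>as. [:- a, 1:])" "length as = N"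
    using char_poly_factorized[OF assms] by blast
  have "proots (char_poly A) = mset as"
    unfolding as(1) by (rule proots_prod_linear)
  then show "(\<Prod>a\<in>#proots (char_poly A). [:- a, 1:]) = char_poly A" "size (proots (char_poly A)) = N"
    using as by (simp_all flip: mset_map prod_mset_prod_list)
qed

lemma Spec_mset_tendsto:
  assumes "finite X" "\<And>x y. x \<in> X \<Longrightarrow> y \<in> X \<Longrightarrow> ((\<lambda>n. P n x y) \<longlongrightarrow> P' x y) F"
  shows "mset_tendsto (\<lambda>n. Spec_mset (P n) X) (Spec_mset P' X) F"
proof (rule mset_tendsto_roots)
  define N where "N = length (enum_list X)"
  have carrier: "kernel_cmat P X \<in> carrier_mat N N" for P
    unfolding N_def by (rule kernel_cmat_carrier)
  show "size (Spec_mset (P n) X) = size (Spec_mset P' X)" for n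
    unfolding Spec_mset_def prod_mset_proots_char_poly[OF carrier] ..
  show "((\<lambda>n. coeff (\<Prod>a\<in>#Spec_mset (P n) X. [:- a, 1:]) i) \<longlongrightarrow> coeff (\<Prod>a\<in>#Spec_mset P' X. [:- a, 1:]) i) F" for i
    unfolding Spec_mset_def prod_mset_proots_char_poly[OF carrier]
  proof (rule tendsto_coeff_char_poly[OF carrier carrier])
    fix i j assume "i < N" "j < N"
    then show "((\<lambda>n. kernel_cmat (P n) X $$ (i, j)) \<longlongrightarrow> kernel_cmat P' X $$ (i, j)) F"
      using enum_list[OF assms(1)] nth_mem unfolding N_def
      by (auto simp: kernel_cmat_def kernel_mat_def intro!: tendsto_of_real assms(2))
  qed
qed

lemma set_Spec_mset: "set_mset (Spec_mset P X) = Spec P X"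
proof -
  have "char_poly (kernel_cmat P X) \<noteq> 0"
    using degree_monic_char_poly[OF kernel_cmat_carrier] by (metis coeff_0 zero_neq_one)
  then show ?thesis
    by (simp add: Spec_mset_def Spec_def spectrum_root_char_poly[OF kernel_cmat_carrier])
qed

text \<open>The spectrum is complex while the claim is real: a singular complex matrix would have
  eigenvalue 0, and its determinant is the image of the real one.\<close>

lemma invertible_kernel_mat:
  assumes "0 \<notin> Spec P X"
  shows "invertible_mat (kernel_mat P (enum_list X))"
proof -
  let ?N = "length (enum_list X)"
  let ?A = "kernel_mat P (enum_list X)"
  have carrier: "?A \<in> carrier_mat ?N ?N" by (simp add: kernel_mat_def)
  have "det (kernel_cmat P X) \<noteq> 0"
  proof
    assume "det (kernel_cmat P X) = 0"
    then have "\<exists>v. v \<in> carrier_vec ?N \<and> v \<noteq> 0\<^sub>v ?N \<and> kernel_cmat P X *\<^sub>v v = 0\<^sub>v ?N"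
      using det_0_iff_vec_prod_zero_field[of "kernel_cmat P X" ?N] by (auto simp: kernel_cmat_def kernel_mat_def)
    moreover have "0 \<cdot>\<^sub>v v = 0\<^sub>v ?N" if "v \<in> carrier_vec ?N" for v :: "complex vec"
      using that by (intro eq_vecI) auto
    ultimately have "eigenvalue (kernel_cmat P X) 0"
      unfolding eigenvalue_def eigenvector_def
      using carrier by (force simp: kernel_cmat_def)
    then show False using assms by (simp add: Spec_def spectrum_def)
  qed
  then have "det ?A \<noteq> 0" by (simp add: kernel_cmat_def)
  from det_non_zero_imp_unit[OF carrier this] show ?thesis
    using carrier unfolding Units_def ring_mat_def invertible_mat_def inverts_mat_def by force
qed

section \<open>Burnside kernels and lumpings\<close>

lemma one_in_Spec:
  assumes "finite X" "X \<noteq> {}" "\<And>x. x \<in> X \<Longrightarrow> (\<Sum>y\<in>X. P x y) = 1"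
  shows "1 \<in> Spec P X"
  unfolding Spec_iff_eigenfun[OF assms(1)] kernel_eigenfun_def
  using assms(2,3) by (intro exI[of _ "\<lambda>_. 1"]) (auto simp flip: of_real_sum)

text \<open>The two half-steps of the Burnside process: \<open>A\<close> picks a uniform element of
  the stabilizer of x, \<open>B\<close> a uniform fixed point of g. One order of composition is the
  primal kernel, the other the dual. An element stabilizing some x has a fixed point, so the
  intermediate state lies in \<open>H\<close>.\<close>

lemma Spec_burnside_dual:
  fixes G (structure)
  assumes "finite X" "finite (carrier G)" and H_def: "H = {g \<in> carrier G. invariants X \<phi> g \<noteq> {}}"
  shows "Spec (burnside_kernel G X \<phi>) X - {0} = Spec (dual_burnside_kernel G X \<phi>) H - {0}"
proof -
  have fin: "finite H" using assms(2) by (simp add: H_def)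
  define A where "A x g = 1 / real (card (stabilizer G \<phi> x)) * of_bool (\<phi> g x = x)" for x g
  define B where "B g x = 1 / real (card (invariants X \<phi> g)) * of_bool (\<phi> g x = x)" for g x
  have "burnside_kernel G X \<phi> x y = (\<Sum>g\<in>H. A x g * B g y)" if "x \<in> X" "y \<in> X" for x y
  proof -
    have "(\<Sum>g\<in>H. A x g * B g y) = (\<Sum>g\<in>stabilizer G \<phi> x \<inter> stabilizer G \<phi> y. A x g * B g y)"
      using fin that by (intro sum.mono_neutral_right)
        (auto simp: A_def B_def H_def stabilizer_def invariants_def)
    also have "\<dots> = burnside_kernel G X \<phi> x y"
      unfolding burnside_kernel_def sum_distrib_left
      by (intro sum.cong) (auto simp: A_def B_def stabilizer_def)
    finally show ?thesis ..
  qed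
  then have K: "Spec (burnside_kernel G X \<phi>) X = Spec (\<lambda>x y. \<Sum>g\<in>H. A x g * B g y) X"
    by (intro Spec_cong assms(1))
  have "dual_burnside_kernel G X \<phi> g h = (\<Sum>x\<in>X. B g x * A x h)" for g h
  proof -
    have "(\<Sum>x\<in>X. B g x * A x h) = (\<Sum>x\<in>invariants X \<phi> g \<inter> invariants X \<phi> h. B g x * A x h)"
      using assms(1) by (intro sum.mono_neutral_right) (auto simp: A_def B_def invariants_def)
    also have "\<dots> = dual_burnside_kernel G X \<phi> g h"
      unfolding dual_burnside_kernel_def sum_distrib_left
      by (intro sum.cong) (auto simp: A_def B_def invariants_def)
    finally show ?thesis ..
  qed
  then have Q: "Spec (dual_burnside_kernel G X \<phi>) H = Spec (\<lambda>g h. \<Sum>x\<in>X. B g x * A x h) H"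
    by (intro Spec_cong fin)
  show ?thesis unfolding K Q by (rule Spec_comp_commute[OF assms(1) fin])
qed

text \<open>Scaling row g by the number of fixed points of g leaves the Gram form of the incidence
  matrix with weights 1 / |stabilizer of x|.\<close>

lemma Spec_dual_burnside_nonneg:
  fixes G (structure)
  assumes "finite X" "finite H" "\<And>g. g \<in> H \<Longrightarrow> invariants X \<phi> g \<noteq> {}"
    and "c \<in> Spec (dual_burnside_kernel G X \<phi>) H"
  shows "\<exists>r\<ge>0. c = complex_of_real r"
proof (rule Spec_gram_nonneg[OF assms(2,1) _ _ _ assms(4)])
  have fin: "finite (invariants X \<phi> g)" for g
    using assms(1) by (simp add: invariants_def)
  show pos: "0 < real (card (invariants X \<phi> g))" if "g \<in> H" for g
    using fin assms(3)[OF that] by (simp add: card_gt_0_iff)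
  show "0 \<le> 1 / real (card (stabilizer G \<phi> x))" for x by simp
  fix g h assume gh: "g \<in> H" "h \<in> H"
  have "real (card (invariants X \<phi> g)) * dual_burnside_kernel G X \<phi> g h =
      (\<Sum>x\<in>invariants X \<phi> g \<inter> invariants X \<phi> h. 1 / real (card (stabilizer G \<phi> x)))"
    using pos[OF gh(1)] by (simp add: dual_burnside_kernel_def)
  also have "\<dots> = (\<Sum>x\<in>X. 1 / real (card (stabilizer G \<phi> x)) * of_bool (\<phi> g x = x) * of_bool (\<phi> h x = x))"
    using assms(1) by (intro sum.mono_neutral_cong_left) (auto simp: invariants_def)
  finally show "real (card (invariants X \<phi> g)) * dual_burnside_kernel G X \<phi> g h =
    (\<Sum>x\<in>X. 1 / real (card (stabilizer G \<phi> x)) * of_bool (\<phi> g x = x) * of_bool (\<phi> h x = x))" .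
qed

lemma sum_dual_burnside_kernel:
  fixes G (structure)
  assumes "group_action G X \<phi>" "finite X" "finite (carrier G)" "g \<in> carrier G" "invariants X \<phi> g \<noteq> {}"
  shows "(\<Sum>h | h \<in> carrier G \<and> invariants X \<phi> h \<noteq> {}. dual_burnside_kernel G X \<phi> g h) = 1"
proof -
  let ?H = "{h \<in> carrier G. invariants X \<phi> h \<noteq> {}}"
  let ?I = "invariants X \<phi>"
  have fin: "finite (?I h)" for h using assms(2) by (simp add: invariants_def)
  have stab: "real (card (stabilizer G \<phi> x)) > 0" if "x \<in> X" for x
    using subgroup.one_closed[OF group_action.stabilizer_subgroup[OF assms(1) that]]
      finite_subset[OF _ assms(3), of "stabilizer G \<phi> x"]
    by (auto simp: card_gt_0_iff stabilizer_def)
  have "(\<Sum>h\<in>?H. \<Sum>x\<in>?I g \<inter> ?I h. 1 / real (card (stabilizer G \<phi> x))) =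
      (\<Sum>h\<in>?H. \<Sum>x\<in>?I g. of_bool (x \<in> ?I h) / real (card (stabilizer G \<phi> x)))"
    by (intro sum.cong refl sum.mono_neutral_cong_left) (auto simp: fin)
  also have "\<dots> = (\<Sum>x\<in>?I g. \<Sum>h\<in>?H. of_bool (x \<in> ?I h) / real (card (stabilizer G \<phi> x)))"
    by (rule sum.swap)
  also have "\<dots> = (\<Sum>x\<in>?I g. 1)"
  \<comment> \<open>Each x fixed by g is counted once for every element of its stabilizer, with
    weight the reciprocal of the stabilizer's order.\<close>
  proof (rule sum.cong[OF refl])
    fix x assume "x \<in> ?I g"
    then have x: "x \<in> X" by (simp add: invariants_def)
    have "(\<Sum>h\<in>?H. of_bool (x \<in> ?I h) / real (card (stabilizer G \<phi> x))) =
        (\<Sum>h\<in>stabilizer G \<phi> x. 1 / real (card (stabilizer G \<phi> x)))"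
      using assms(3) x by (intro sum.mono_neutral_cong_right) (auto simp: stabilizer_def invariants_def)
    also have "\<dots> = 1" using stab[OF x] by simp
    finally show "(\<Sum>h\<in>?H. of_bool (x \<in> ?I h) / real (card (stabilizer G \<phi> x))) = 1" .
  qed
  finally show ?thesis
    unfolding dual_burnside_kernel_def sum_distrib_left[symmetric]
    using fin[of g] assms(5) by simp
qed

text \<open>Rows of \<open>P\<close> are constant on blocks, which is stronger than strong
  lumpability. Hence P = A B with \<open>A\<close> the block membership and \<open>B\<close> the
  rows of the representatives, and B A is the lumping; only the eigenvalue 0 can be lost or gained.
  An index with an empty block has an arbitrary row but a zero column.\<close>

lemma Spec_lumped_kernel:
  assumes "finite Y" "finite I" "f ` Y \<subseteq> I"
    and "\<And>g g' h. g \<in> Y \<Longrightarrow> g' \<in> Y \<Longrightarrow> f g = f g' \<Longrightarrow> P g h = P g' h"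
  shows "Spec P Y - {0} = Spec (lumped_kernel P (\<lambda>S. {g \<in> Y. f g = S})) I - {0}"
proof -
  define r where "r S = (SOME g. g \<in> {g \<in> Y. f g = S})" for S
  define A :: "'a \<Rightarrow> 'b \<Rightarrow> real" where "A g S = of_bool (f g = S)" for g S
  define B where "B S h = P (r S) h" for S h
  have "P g h = (\<Sum>S\<in>I. A g S * B S h)" if "g \<in> Y" for g h
  proof -
    have "r (f g) \<in> {g' \<in> Y. f g' = f g}"
      unfolding r_def by (rule someI[of _ g]) (use that in simp)
    then have "P g h = B (f g) h"
      unfolding B_def using assms(4)[of "r (f g)" g h] that by simp
    also have "\<dots> = (\<Sum>S\<in>{f g}. A g S * B S h)" by (simp add: A_def)
    also have "\<dots> = (\<Sum>S\<in>I. A g S * B S h)"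
      using assms(2,3) that by (intro sum.mono_neutral_left) (auto simp: A_def)
    finally show ?thesis .
  qed
  then have 1: "Spec P Y = Spec (\<lambda>g h. \<Sum>S\<in>I. A g S * B S h) Y"
    by (intro Spec_cong assms(1))
  have "lumped_kernel P (\<lambda>S. {g \<in> Y. f g = S}) S T = (\<Sum>h\<in>Y. B S h * A h T)" for S T
    unfolding lumped_kernel_def r_def[symmetric]
    using assms(1) by (intro sum.mono_neutral_cong_left) (auto simp: A_def B_def)
  then have 2: "Spec (lumped_kernel P (\<lambda>S. {g \<in> Y. f g = S})) I = Spec (\<lambda>S T. \<Sum>h\<in>Y. B S h * A h T) I"
    by (intro Spec_cong assms(2))
  show ?thesis unfolding 1 2 by (rule Spec_comp_commute[OF assms(1,2)])
qed

section \<open>Derangements\<close>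

lemma card_derangements:
  assumes "finite A"
  shows "card {p. p permutes A \<and> (\<forall>x\<in>A. p x \<noteq> x)} = derangements (card A)"
proof -
  obtain f where "bij_betw f A {1..card A}"
    using ex_bij_betw_finite_nat[OF assms] ex_bij_betw_nat_finite_1[OF assms] bij_betw_inv_into by blast
  from bij_betw_same_card[OF bij_betw_derangements[OF this]] show ?thesis
    by (simp add: derangements_def)
qed

lemma derangements_0: "derangements 0 = 1"
proof -
  have "{p. p permutes {1..0::nat} \<and> (\<forall>i\<in>{1..0}. p i \<noteq> i)} = {id}" by auto
  then show ?thesis by (simp add: derangements_def)
qed

lemma derangements_1: "derangements (Suc 0) = 0"
proof -
  have "{p. p permutes {1..Suc 0} \<and> (\<forall>i\<in>{1..Suc 0}. p i \<noteq> i)} = {}" by auto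
  then show ?thesis by (simp add: derangements_def)
qed

lemma derangements_pos:
  assumes "m \<ge> 2"
  shows "derangements m > 0"
proof -
  \<comment> \<open>The cycle 1, 2, ..., m, 1.\<close>
  define p where "p i = (if i \<in> {1..m} then if i = m then 1 else Suc i else i)" for i
  have "inj_on p {1..m}" using assms by (auto simp: inj_on_def p_def split: if_splits)
  moreover have "p ` {1..m} \<subseteq> {1..m}" using assms by (auto simp: p_def)
  ultimately have "bij_betw p {1..m} {1..m}"
    by (simp add: bij_betw_def endo_inj_surj)
  then have "p permutes {1..m}"
    by (rule bij_imp_permutes) (use assms in \<open>auto simp: p_def\<close>)
  moreover have "\<forall>i\<in>{1..m}. p i \<noteq> i" using assms by (auto simp: p_def)
  ultimately have "{p. p permutes {1..m} \<and> (\<forall>i\<in>{1..m}. p i \<noteq> i)} \<noteq> {}" by blast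
  moreover have "finite {p. p permutes {1..m} \<and> (\<forall>i\<in>{1..m}. p i \<noteq> i)}"
    using finite_permutations[of "{1..m}"] by (rule rev_finite_subset) auto
  ultimately show ?thesis by (simp add: derangements_def card_gt_0_iff)
qed

text \<open>Composing a derangement \<open>p\<close> with the transposition of \<open>1\<close> and \<open>p 1 = b\<close> makes \<open>1\<close> a fixed
  point and creates at most one further fixed point, namely \<open>b\<close>.\<close>

lemma derangements_recurrence_le:
  assumes "m \<ge> 2"
  shows "derangements m \<le> (m - 1) * (derangements (m - 1) + derangements (m - 2))"
proof -
  define D where "D A = {p. p permutes A \<and> (\<forall>x\<in>A. p x \<noteq> x)}" for A :: "nat set"
  have fin: "finite (D A)" if "finite A" for A
    using finite_permutations[OF that] by (rule rev_finite_subset) (auto simp: D_def)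
  have card_D: "card (D A) = derangements (card A)" if "finite A" for A
    using card_derangements[OF that] by (simp add: D_def)
  have *: "card {p \<in> D {1..m}. p 1 = b} \<le> derangements (m - 1) + derangements (m - 2)"
    if b: "b \<in> {2..m}" for b
  proof -
    have "(\<lambda>p. Transposition.transpose 1 b \<circ> p) ` {p \<in> D {1..m}. p 1 = b} \<subseteq> D {2..m} \<union> D ({2..m} - {b})"
    proof (rule image_subsetI)
      fix p assume "p \<in> {p \<in> D {1..m}. p 1 = b}"
      then have p: "p permutes {1..m}" "\<And>x. x \<in> {1..m} \<Longrightarrow> p x \<noteq> x" "p 1 = b"
        by (auto simp: D_def)
      define q where "q = Transposition.transpose 1 b \<circ> p"
      have "q permutes {1..m}"
        unfolding q_def by (rule permutes_compose[OF p(1) permutes_swap_id]) (use b in auto)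
      moreover have "q 1 = 1" using p(3) by (simp add: q_def)
      ultimately have q: "q permutes {2..m}"
        by (elim permutes_superset) (auto, metis One_nat_def Suc_leI le_neq_implies_less numeral_2_eq_2)
      have ne: "q x \<noteq> x" if x: "x \<in> {2..m}" "x \<noteq> b" for x
      proof
        assume "q x = x"
        then have "p x = Transposition.transpose 1 b x"
          unfolding q_def by (metis comp_apply transpose_involutory)
        then show False using x p(2)[of x] by (auto simp: transpose_def)
      qed
      have "q \<in> D {2..m} \<union> D ({2..m} - {b})"
      proof (cases "q b = b")
        case True
        then have "q permutes {2..m} - {b}" by (intro permutes_superset[OF q]) auto
        then show ?thesis using ne by (auto simp: D_def)
      next
        case False
        then have "\<forall>x\<in>{2..m}. q x \<noteq> x" using ne by metis
        then show ?thesis using q by (auto simp: D_def)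
      qed
      then show "Transposition.transpose 1 b \<circ> p \<in> D {2..m} \<union> D ({2..m} - {b})"
        unfolding q_def .
    qed
    moreover have "inj_on (\<lambda>p. Transposition.transpose 1 b \<circ> p) {p \<in> D {1..m}. p 1 = b}"
      by (rule inj_onI) (metis comp_assoc id_comp transpose_comp_involutory)
    ultimately have "card {p \<in> D {1..m}. p 1 = b} \<le> card (D {2..m} \<union> D ({2..m} - {b}))"
      by (intro card_inj_on_le) (auto simp: fin)
    also have "\<dots> \<le> card (D {2..m}) + card (D ({2..m} - {b}))" by (rule card_Un_le)
    also have "\<dots> = derangements (m - 1) + derangements (m - 2)"
      using b by (simp add: card_D diff_diff_left numeral_2_eq_2)
    finally show ?thesis .
  qed
  have "D {1..m} = (\<Union>b\<in>{2..m}. {p \<in> D {1..m}. p 1 = b})"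
  proof -
    have "p 1 \<in> {2..m}" if "p \<in> D {1..m}" for p
    proof -
      have "p 1 \<in> {1..m}" "p 1 \<noteq> 1"
        using that permutes_in_image[of p "{1..m}" 1] assms by (auto simp: D_def)
      then show ?thesis by auto
    qed
    then show ?thesis by blast
  qed
  then have "derangements m = card (\<Union>b\<in>{2..m}. {p \<in> D {1..m}. p 1 = b})"
    using card_D[of "{1..m}"] by simp
  also have "\<dots> \<le> (\<Sum>b\<in>{2..m}. card {p \<in> D {1..m}. p 1 = b})" by (rule card_UN_le) simp
  also have "\<dots> \<le> (\<Sum>b\<in>{2..m}. derangements (m - 1) + derangements (m - 2))"
    by (rule sum_mono) (rule *)
  finally show ?thesis by simp
qed

text \<open>Induction by the recurrence, with (m-1) ((m-1)! + (m-2)!) = m!. The case m = 2 stands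
  apart because the recurrence then reaches !0 = 1, where the bound fails.\<close>

lemma two_derangements_le_fact:
  assumes "m \<ge> 1"
  shows "2 * derangements m \<le> fact m"
  using assms
proof (induction m rule: less_induct)
  case (less m)
  consider "m = 1" | "m = 2" | "m \<ge> 3" using less.prems by linarith
  then show ?case
  proof cases
    case 1
    then show ?thesis by (simp add: derangements_1)
  next
    case 2
    then show ?thesis
      using derangements_recurrence_le[of 2] by (simp add: derangements_0 derangements_1 numeral_2_eq_2)
  next
    case 3
    then obtain l where m: "m = Suc (Suc l)" "l \<ge> 1"
      by (metis Suc_le_D Suc_le_mono numeral_3_eq_3 One_nat_def)
    have "2 * derangements m \<le> Suc l * (2 * derangements (Suc l) + 2 * derangements l)"
      using derangements_recurrence_le[of m] m by (simp add: algebra_simps)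
    also have "\<dots> \<le> Suc l * (fact (Suc l) + fact l)"
      using less.IH[of "Suc l"] less.IH[of l] m by (intro mult_left_mono add_mono) auto
    also have "\<dots> = fact m" by (simp add: m algebra_simps)
    finally show ?thesis .
  qed
qed

lemma theta_self: "theta k k = 1"
  by (simp add: theta_def derangements_0)

lemma theta_le_half:
  assumes "r < k"
  shows "theta k r \<le> 1 / 2"
proof -
  have "real (2 * derangements (k - r)) \<le> real (fact (k - r))"
    using two_derangements_le_fact[of "k - r"] assms by (simp only: of_nat_le_iff)
  then show ?thesis by (simp add: theta_def field_simps)
qed

text \<open>Only !1 vanishes among the derangement numbers; this matches the exclusion of sets of
  size k - 1 from \<open>fs_index\<close>.\<close>

lemma theta_pos:
  assumes "k - r \<noteq> 1"
  shows "theta k r > 0"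
proof -
  have "derangements (k - r) > 0"
    using assms derangements_pos[of "k - r"] derangements_0 by (cases "k - r = 0") auto
  then show ?thesis by (simp add: theta_def)
qed

lemma theta_minus_2:
  assumes "k \<ge> 2"
  shows "theta k (k - 2) = 1 / 2"
proof -
  \<comment> \<open>Squeezed between 2 * !2 <= 2! and !2 > 0.\<close>
  have "derangements 2 = 1"
    using two_derangements_le_fact[of 2] derangements_pos[of 2] by (simp add: fact_numeral)
  then show ?thesis using assms by (simp add: theta_def)
qed

section \<open>The kernel lumped by fixed symbols\<close>

lemma finite_fs_index: "finite (fs_index k)"
  by (rule finite_subset[of _ "Pow {1..k}"]) (auto simp: fs_index_def)

text \<open>A permutation fixing all symbols but one permutes a singleton, so it fixes the last
  symbol too.\<close>

lemma Fix_in_fs_index: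
  assumes "g \<in> sym_star k" "k \<ge> 1"
  shows "Fix k g \<in> fs_index k"
proof -
  have g: "g permutes {1..k}" "Fix k g \<noteq> {}" using assms by (auto simp: sym_star_def sym_group_def)
  have "card (Fix k g) \<noteq> k - 1"
  proof
    assume "card (Fix k g) = k - 1"
    then have "card ({1..k} - Fix k g) = 1"
      using assms(2) by (subst card_Diff_subset) (auto simp: Fix_def)
    then obtain a where a: "{1..k} - Fix k g = {a}" by (auto simp: card_1_singleton_iff)
    have "x \<in> Fix k g" if "x \<in> {1..k} - {a}" for x
      using a that by blast
    then have "g permutes {a}"
      by (intro permutes_superset[OF g(1)]) (auto simp: Fix_def)
    then have "g a = a" by simp
    moreover have "a \<in> {1..k}" "a \<notin> Fix k g" using a by blast+
    ultimately show False by (simp add: Fix_def)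
  qed
  then show ?thesis using g by (auto simp: fs_index_def Fix_def)
qed

text \<open>Since \<open>permutes\<close> means identity outside the set, the permutations with
  fixed set T are literally the derangements of the complement of T.\<close>

lemma card_fs_block:
  assumes "T \<in> fs_index k"
  shows "card (fs_block k T) = derangements (k - card T)"
proof -
  have T: "T \<subseteq> {1..k}" "T \<noteq> {}" using assms by (auto simp: fs_index_def)
  have "fs_block k T = {p. p permutes ({1..k} - T) \<and> (\<forall>x\<in>{1..k} - T. p x \<noteq> x)}" (is "_ = ?D")
  proof (intro equalityI subsetI)
    fix p assume "p \<in> fs_block k T"
    then have p: "p permutes {1..k}" "Fix k p = T" by (auto simp: fs_block_def sym_star_def sym_group_def)
    then have "p permutes ({1..k} - T)"
      by (intro permutes_superset[OF p(1)]) (auto simp: Fix_def)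
    then show "p \<in> ?D" using p by (auto simp: Fix_def)
  next
    fix p assume p: "p \<in> ?D"
    then have "p permutes {1..k}" by (auto intro: permutes_subset)
    moreover have "p x = x" if "x \<in> T" for x
      using p that permutes_not_in[of p "{1..k} - T" x] by blast
    then have "Fix k p = T" using p T by (auto simp: Fix_def)
    ultimately show "p \<in> fs_block k T" using T by (auto simp: fs_block_def sym_star_def sym_group_def)
  qed
  then have "card (fs_block k T) = derangements (card ({1..k} - T))"
    by (simp add: card_derangements)
  also have "card ({1..k} - T) = k - card T"
    using T by (subst card_Diff_subset) (auto intro: finite_subset)
  finally show ?thesis .
qed

lemma fs_block_nonempty:
  assumes "S \<in> fs_index k"
  obtains g where "g \<in> fs_block k S"
proof -
  have "card S \<noteq> k - 1" "card S \<noteq> 0" "card S \<le> k"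
    using assms card_mono[of "{1..k}" S] finite_subset[of S "{1..k}"] by (auto simp: fs_index_def)
  then have "k - card S = 0 \<or> k - card S \<ge> 2" by linarith
  then have "derangements (k - card S) > 0"
    using derangements_pos derangements_0 by auto
  then have "fs_block k S \<noteq> {}" using card_fs_block[OF assms] by auto
  then show ?thesis using that by blast
qed

lemma invariants_eq_PiE:
  "invariants (words k n) (word_action k n) g = {1..n} \<rightarrow>\<^sub>E Fix k g"
  by (subst invariants_word_action) (auto simp: words_def PiE_iff Fix_def extensional_def)

text \<open>A permutation fixes a word exactly when it fixes every letter occurring in it.\<close>

lemma stabilizer_word_action:
  assumes "x \<in> words k n"
  shows "stabilizer (sym_group k) (word_action k n) x = {g. g permutes {1..k} - x ` {1..n}}"
proof -
  have x: "x ` {1..n} \<subseteq> {1..k}" using assms by (auto simp: words_def)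
  have "g \<in> stabilizer (sym_group k) (word_action k n) x \<longleftrightarrow>
      g permutes {1..k} \<and> x \<in> invariants (words k n) (word_action k n) g" for g
    using assms by (auto simp: stabilizer_def invariants_def sym_group_def)
  also have "\<dots> g \<longleftrightarrow> g permutes {1..k} \<and> (\<forall>a\<in>x ` {1..n}. g a = a)" for g
    using assms x by (auto simp: invariants_word_action Fix_def)
  also have "\<dots> g \<longleftrightarrow> g permutes {1..k} - x ` {1..n}" for g
    by (auto intro: permutes_subset[of _ "{1..k} - x ` {1..n}"] permutes_superset dest: permutes_not_in)
  finally show ?thesis by blast
qed

lemma card_stabilizer_word_action:
  assumes "x \<in> words k n"
  shows "card (stabilizer (sym_group k) (word_action k n) x) = fact (k - card (x ` {1..n}))"
proof -
  have "x ` {1..n} \<subseteq> {1..k}" using assms by (auto simp: words_def)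
  then have "card ({1..k} - x ` {1..n}) = k - card (x ` {1..n})"
    by (simp add: card_Diff_subset)
  then show ?thesis
    unfolding stabilizer_word_action[OF assms] by (intro card_permutations) auto
qed

text \<open>The words fixed by both permutations are the words over the common fixed symbols. So
  \<open>Q_kernel\<close> is constant for h in the block of T, and the sum over h only contributes
  the block size.\<close>

lemma Q_fs_formula:
  assumes "S \<in> fs_index k" "T \<in> fs_index k"
  shows "Q_fs k n S T = real (derangements (k - card T)) *
    ((\<Sum>x\<in>{1..n} \<rightarrow>\<^sub>E (S \<inter> T). 1 / fact (k - card (x ` {1..n}))) / real (card S) ^ n)"
proof -
  obtain g where g: "g \<in> fs_block k S" using fs_block_nonempty[OF assms(1)] .
  then have [simp]: "Fix k g = S" by (simp add: fs_block_def)
  have S: "S \<subseteq> {1..k}" using assms by (simp add: fs_index_def)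
  have "Q_kernel k n g h = (\<Sum>x\<in>{1..n} \<rightarrow>\<^sub>E (S \<inter> T). 1 / fact (k - card (x ` {1..n}))) / real (card S) ^ n"
    if "h \<in> fs_block k T" for h
  proof -
    have [simp]: "Fix k h = T" using that by (simp add: fs_block_def)
    have "({1..n} \<rightarrow>\<^sub>E S) \<inter> ({1..n} \<rightarrow>\<^sub>E T) = {1..n} \<rightarrow>\<^sub>E (S \<inter> T)" by (auto simp: PiE_iff)
    moreover have "x \<in> words k n" if "x \<in> {1..n} \<rightarrow>\<^sub>E (S \<inter> T)" for x
      using that S by (auto simp: words_def PiE_iff)
    ultimately show ?thesis
      by (simp add: Q_kernel_def dual_burnside_kernel_def invariants_eq_PiE card_PiE
          card_stabilizer_word_action cong: sum.cong)
  qed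
  then show ?thesis
    unfolding Q_fs_eq[OF g] by (simp add: card_fs_block[OF assms(2)])
qed

section \<open>Averages over random words as the length grows\<close>

lemma LIMSEQ_null_bound:
  fixes f g :: "nat \<Rightarrow> real"
  assumes "\<And>n. \<bar>f n\<bar> \<le> g n" "g \<longlonglongrightarrow> 0"
  shows "f \<longlonglongrightarrow> 0"
proof (rule tendsto_0_le[OF assms(2), of _ 1], rule always_eventually, rule allI)
  show "norm (f n) \<le> norm (g n) * 1" for n
    using assms(1)[of n] by simp
qed

lemma tendsto_power_ratio:
  assumes "a < b"
  shows "(\<lambda>n. real a ^ n / real b ^ n) \<longlonglongrightarrow> 0"
  unfolding power_divide[symmetric] using assms by (intro LIMSEQ_realpow_zero) auto

text \<open>A uniformly random word over the alphabet \<open>S\<close> misses some letter with probability at most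
  \<open>|S| (1 - 1 / |S|) ^ n\<close>.\<close>

lemma tendsto_word_average:
  fixes c :: "nat \<Rightarrow> real"
  assumes "finite S" "S \<noteq> {}"
  shows "(\<lambda>n. (\<Sum>x\<in>{1..n} \<rightarrow>\<^sub>E (S \<inter> T). c (card (x ` {1..n}))) / real (card S) ^ n)
    \<longlonglongrightarrow> c (card S) * of_bool (S \<subseteq> T)"
proof -
  define s where "s = card S"
  define C where "C = Max ((\<lambda>i. \<bar>c i\<bar>) ` {..s})"
  have C: "\<bar>c i\<bar> \<le> C" if "i \<le> s" for i
    unfolding C_def using that by (intro Max_ge) auto
  have s: "s > 0" using assms by (simp add: s_def card_gt_0_iff)
  have card_le: "card (x ` {1..n}) \<le> s" if "x \<in> {1..n} \<rightarrow>\<^sub>E S" for x n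
    unfolding s_def using that assms(1) by (intro card_mono) auto
  show ?thesis
  proof (cases "S \<subseteq> T")
    case False
    then have less: "card (S \<inter> T) < s"
      unfolding s_def using assms(1) by (intro psubset_card_mono) auto
    \<comment> \<open>Words over the smaller alphabet are an exponentially small fraction of all
      words over \<open>S\<close>.\<close>
    have "\<bar>(\<Sum>x\<in>{1..n} \<rightarrow>\<^sub>E (S \<inter> T). c (card (x ` {1..n}))) / real s ^ n\<bar>
        \<le> C * (real (card (S \<inter> T)) ^ n / real s ^ n)" for n
    proof -
      have "\<bar>\<Sum>x\<in>{1..n} \<rightarrow>\<^sub>E (S \<inter> T). c (card (x ` {1..n}))\<bar> \<le> (\<Sum>x\<in>{1..n} \<rightarrow>\<^sub>E (S \<inter> T). C)"
        by (rule order.trans[OF sum_abs sum_mono], intro C card_le) (auto simp: PiE_iff)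
      then show ?thesis by (simp add: card_PiE abs_divide power_abs divide_right_mono mult.commute)
    qed
    moreover have "(\<lambda>n. C * (real (card (S \<inter> T)) ^ n / real s ^ n)) \<longlonglongrightarrow> C * 0"
      by (intro tendsto_intros tendsto_power_ratio less)
    ultimately show ?thesis
      using False unfolding s_def[symmetric]
      using LIMSEQ_null_bound[where g = "\<lambda>n. C * (real (card (S \<inter> T)) ^ n / real s ^ n)"] by simp
  next
    case True
    then have ST: "S \<inter> T = S" by blast
    \<comment> \<open>A word using all of \<open>S\<close> contributes nothing to the difference;
      each other word contributes at most 2 C, and a union bound over the missing letter counts
      them.\<close>
    have "\<bar>(\<Sum>x\<in>{1..n} \<rightarrow>\<^sub>E S. c (card (x ` {1..n}))) / real s ^ n - c s\<bar>
        \<le> 2 * C * s * (real (s - 1) ^ n / real s ^ n)" for n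
    proof -
      let ?W = "{1..n} \<rightarrow>\<^sub>E S" and ?N = "\<Union>a\<in>S. {1..n} \<rightarrow>\<^sub>E (S - {a})"
      have fin: "finite ?W" by (intro finite_PiE) (auto simp: assms)
      have zero: "c (card (x ` {1..n})) - c s = 0" if "x \<in> ?W - ?N" for x
      proof -
        have "x ` {1..n} = S" using that by (force simp: PiE_iff)
        then show ?thesis by (simp add: s_def)
      qed
      have "\<bar>(\<Sum>x\<in>?W. c (card (x ` {1..n}))) - c s * real s ^ n\<bar> = \<bar>\<Sum>x\<in>?W. c (card (x ` {1..n})) - c s\<bar>"
        by (simp add: sum_subtractf card_PiE s_def mult.commute)
      also have "(\<Sum>x\<in>?W. c (card (x ` {1..n})) - c s) = (\<Sum>x\<in>?N. c (card (x ` {1..n})) - c s)"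
        by (intro sum.mono_neutral_right fin ballI zero) (auto simp: PiE_iff)
      also have "\<bar>\<dots>\<bar> \<le> (\<Sum>x\<in>?N. 2 * C)"
      proof (rule order.trans[OF sum_abs sum_mono])
        fix x assume "x \<in> ?N"
        then have "card (x ` {1..n}) \<le> s" by (intro card_le) (auto simp: PiE_iff)
        from C[OF this] C[of s] show "\<bar>c (card (x ` {1..n})) - c s\<bar> \<le> 2 * C" by linarith
      qed
      also have "\<dots> = 2 * C * real (card ?N)" by simp
      also have "\<dots> \<le> 2 * C * real (s * (s - 1) ^ n)"
      proof (rule mult_left_mono)
        have "card ?N \<le> (\<Sum>a\<in>S. card ({1..n} \<rightarrow>\<^sub>E (S - {a})))" by (rule card_UN_le[OF assms(1)])
        also have "\<dots> = s * (s - 1) ^ n" by (simp add: card_PiE s_def)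
        finally show "real (card ?N) \<le> real (s * (s - 1) ^ n)" by (simp only: of_nat_le_iff)
        show "0 \<le> 2 * C" using C[of 0] by linarith
      qed
      finally have *: "\<bar>(\<Sum>x\<in>?W. c (card (x ` {1..n}))) - c s * real s ^ n\<bar> \<le> 2 * C * s * real (s - 1) ^ n"
        by (simp add: mult.assoc)
      have "\<bar>(\<Sum>x\<in>?W. c (card (x ` {1..n}))) / real s ^ n - c s\<bar> =
          \<bar>(\<Sum>x\<in>?W. c (card (x ` {1..n}))) - c s * real s ^ n\<bar> / real s ^ n"
      proof -
        have "(\<Sum>x\<in>?W. c (card (x ` {1..n}))) / real s ^ n - c s =
            ((\<Sum>x\<in>?W. c (card (x ` {1..n}))) - c s * real s ^ n) / real s ^ n"
          using s by (simp add: diff_divide_distrib)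
        then show ?thesis by (simp add: abs_divide)
      qed
      also have "\<dots> \<le> 2 * C * s * real (s - 1) ^ n / real s ^ n"
        by (intro divide_right_mono *) simp
      finally show ?thesis by simp
    qed
    moreover have "(\<lambda>n. 2 * C * s * (real (s - 1) ^ n / real s ^ n)) \<longlonglongrightarrow> 2 * C * s * 0"
      using s by (intro tendsto_intros tendsto_power_ratio) simp
    ultimately have "(\<lambda>n. (\<Sum>x\<in>{1..n} \<rightarrow>\<^sub>E S. c (card (x ` {1..n}))) / real s ^ n - c s) \<longlonglongrightarrow> 0"
      using LIMSEQ_null_bound[where g = "\<lambda>n. 2 * C * s * (real (s - 1) ^ n / real s ^ n)"] by simp
    then show ?thesis using True by (simp add: ST LIM_zero_iff flip: s_def)
  qed
qed

lemma Q_fs_tendsto: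
  assumes "S \<in> fs_index k" "T \<in> fs_index k"
  shows "(\<lambda>n. Q_fs k n S T) \<longlonglongrightarrow> Q_fs_limit k S T"
proof -
  have "finite S" "S \<noteq> {}" using assms(1) finite_subset[of S "{1..k}"] by (auto simp: fs_index_def)
  from tendsto_mult[OF tendsto_const tendsto_word_average[OF this, where T = T and c = "\<lambda>i. 1 / fact (k - i)"]]
  show ?thesis unfolding Q_fs_formula[OF assms] Q_fs_limit_def
    by (auto intro: tendsto_eq_rhs)
qed

section \<open>The limit kernel and its eigenvalues\<close>

lemma Q_fs_limit_triangular:
  assumes "inclusion_ordering k Ss"
  shows "upper_triangular (kernel_mat (Q_fs_limit k) Ss)"
    and "\<And>i. i < length Ss \<Longrightarrow> kernel_mat (Q_fs_limit k) Ss $$ (i, i) = theta k (card (Ss ! i))"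
proof -
  show "upper_triangular (kernel_mat (Q_fs_limit k) Ss)"
  proof (rule upper_triangularI)
    fix i j assume "j < i" "i < dim_row (kernel_mat (Q_fs_limit k) Ss)"
    then have ij: "j < i" "i < length Ss" "j < length Ss" by (auto simp: kernel_mat_def)
    have "\<not> Ss ! i \<subseteq> Ss ! j"
    proof
      assume "Ss ! i \<subseteq> Ss ! j"
      moreover have "Ss ! i \<noteq> Ss ! j" using assms ij by (auto simp: inclusion_ordering_def nth_eq_iff_index_eq)
      ultimately have "i < j" using assms ij by (auto simp: inclusion_ordering_def)
      then show False using ij by simp
    qed
    then show "kernel_mat (Q_fs_limit k) Ss $$ (i, j) = 0"
      using ij by (simp add: kernel_mat_def Q_fs_limit_def)
  qed
  show "kernel_mat (Q_fs_limit k) Ss $$ (i, i) = theta k (card (Ss ! i))" if "i < length Ss" for i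
    using that by (simp add: kernel_mat_def Q_fs_limit_def theta_def)
qed

lemma image_mset_mset_set_eq_sum: "finite A \<Longrightarrow> image_mset f (mset_set A) = (\<Sum>x\<in>A. {#f x#})"
  by (induction A rule: finite_induct) auto

lemma sum_singleton_mset: "finite A \<Longrightarrow> (\<Sum>x\<in>A. {#c#}) = replicate_mset (card A) c"
  by (induction A rule: finite_induct) auto

lemma fs_index_eq_Union:
  assumes "k \<ge> 3"
  shows "fs_index k = (\<Union>r\<in>{1..k-2} \<union> {k}. {S. S \<subseteq> {1..k} \<and> card S = r})"
proof -
  have "S \<noteq> {} \<and> card S \<noteq> k - 1 \<longleftrightarrow> card S \<in> {1..k-2} \<union> {k}" if "S \<subseteq> {1..k}" for S
  proof -
    have "card S \<le> k" "S \<noteq> {} \<longleftrightarrow> card S \<noteq> 0"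
      using card_mono[OF _ that] finite_subset[OF that] by auto
    then show ?thesis using assms by (simp only: Un_iff atLeastAtMost_iff singleton_iff) linarith
  qed
  then show ?thesis unfolding fs_index_def by blast
qed

lemma Spec_mset_Q_fs_limit:
  assumes "k \<ge> 3"
  shows "Spec_mset (Q_fs_limit k) (fs_index k) =
    (\<Sum>r\<in>{1..k-2} \<union> {k}. replicate_mset (k choose r) (complex_of_real (theta k r)))"
proof -
  let ?f = "\<lambda>S :: nat set. complex_of_real (theta k (card S))"
  obtain Ss where Ss: "inclusion_ordering k Ss" using inclusion_ordering_exists by blast
  then have dist: "distinct Ss" "set Ss = fs_index k" by (auto simp: inclusion_ordering_def)
  let ?A = "map_mat complex_of_real (kernel_mat (Q_fs_limit k) Ss)"
  have A: "?A \<in> carrier_mat (length Ss) (length Ss)" by (simp add: kernel_mat_def)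
  have "upper_triangular ?A"
    using Q_fs_limit_triangular(1)[OF Ss] by (auto simp: upper_triangular_def kernel_mat_def)
  moreover have "diag_mat ?A = map ?f Ss"
    using Q_fs_limit_triangular(2)[OF Ss] by (intro nth_equalityI) (auto simp: diag_mat_def kernel_mat_def)
  ultimately have "char_poly ?A = (\<Prod>a\<leftarrow>map ?f Ss. [:- a, 1:])"
    using char_poly_upper_triangular[OF A] by simp
  then have "Spec_mset (Q_fs_limit k) (fs_index k) = image_mset ?f (mset Ss)"
    unfolding Spec_enum_independent(1)[OF dist] by (simp only: proots_prod_linear mset_map)
  also have "mset Ss = mset_set (fs_index k)"
    using mset_set_set[OF dist(1)] dist(2) by simp
  also have "image_mset ?f (mset_set (fs_index k)) = (\<Sum>S\<in>fs_index k. {#?f S#})"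
    by (rule image_mset_mset_set_eq_sum[OF finite_fs_index])
  also have "\<dots> = (\<Sum>r\<in>{1..k-2} \<union> {k}. \<Sum>S | S \<subseteq> {1..k} \<and> card S = r. {#?f S#})"
    unfolding fs_index_eq_Union[OF assms] by (rule sum.UNION_disjoint) auto
  also have "\<dots> = (\<Sum>r\<in>{1..k-2} \<union> {k}. replicate_mset (k choose r) (complex_of_real (theta k r)))"
  proof (rule sum.cong[OF refl])
    fix r
    have "(\<Sum>S | S \<subseteq> {1..k} \<and> card S = r. {#?f S#}) =
        (\<Sum>S | S \<subseteq> {1..k} \<and> card S = r. {#complex_of_real (theta k r)#})"
      by (rule sum.cong) auto
    also have "\<dots> = replicate_mset (k choose r) (complex_of_real (theta k r))"
      by (subst sum_singleton_mset) (auto simp: n_subsets)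
    finally show "(\<Sum>S | S \<subseteq> {1..k} \<and> card S = r. {#?f S#}) =
      replicate_mset (k choose r) (complex_of_real (theta k r))" .
  qed
  finally show ?thesis .
qed

section \<open>Convergence of the spectral gap\<close>

lemma rel_mset_inL:
  assumes "rel_mset R M N" "a \<in># M"
  obtains b where "b \<in># N" "R a b"
proof -
  have "rel_mset R (add_mset a (M - {#a#})) N" using assms by simp
  from msed_rel_invL[OF this] obtain N' b where "N = add_mset b N'" "R a b" by blast
  then show ?thesis using that[of b] by simp
qed

lemma rel_mset_inR:
  assumes "rel_mset R M N" "b \<in># N"
  obtains a where "a \<in># M" "R a b"
proof -
  have "rel_mset R M (add_mset b (N - {#b#}))" using assms by simp
  from msed_rel_invR[OF this] obtain M' a where "M = add_mset a M'" "R a b" by blast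
  then show ?thesis using that[of a] by simp
qed

lemma mset_tendsto_eventually_nonzero:
  fixes M :: "'b \<Rightarrow> complex multiset"
  assumes "mset_tendsto M L F" "0 \<notin># L"
  shows "\<forall>\<^sub>F n in F. 0 \<notin># M n"
proof -
  \<comment> \<open>The distance from 0 to \<open>L\<close>, capped at 1 so that the minimum exists
    for empty \<open>L\<close>.\<close>
  define e where "e = Min (insert 1 (norm ` set_mset L))"
  have "e > 0" using assms(2) by (auto simp: e_def)
  moreover have le: "e \<le> norm c" if "c \<in># L" for c
    using that by (auto simp: e_def)
  ultimately have "\<forall>\<^sub>F n in F. rel_mset (\<lambda>x y. dist x y < e) (M n) L"
    using assms(1) by (simp add: mset_tendsto_def)
  then show ?thesis
  proof eventually_elim
    case (elim n)
    show ?case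
    proof
      assume "0 \<in># M n"
      then obtain c where "c \<in># L" "dist 0 c < e" using rel_mset_inL[OF elim] by blast
      then show False using le[of c] by simp
    qed
  qed
qed

text \<open>Close to the limit, an element \<open>1\<close> of \<open>M n\<close> can only be matched with the limit element \<open>1\<close>,
  so the remaining elements are matched with \<open>L\<close>.\<close>

lemma tendsto_Max_nontrivial_spectrum:
  fixes M :: "nat \<Rightarrow> complex multiset"
  assumes lim: "mset_tendsto M (add_mset 1 L) sequentially"
    and one: "\<forall>\<^sub>F n in sequentially. 1 \<in># M n"
    and L: "\<And>c. c \<in># L \<Longrightarrow> cmod c \<le> a" "complex_of_real a \<in># L" and a: "0 \<le> a" "a < 1"
  shows "(\<lambda>n. Max (insert 0 (cmod ` (set_mset (M n) - {1})))) \<longlonglongrightarrow> a"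
proof (rule tendstoI)
  fix e :: real assume "e > 0"
  \<comment> \<open>At most half the gap 1 - a, so that a + e' < 1 and nothing close to
    \<open>L\<close> can reach 1.\<close>
  define e' where "e' = min e ((1 - a) / 2)"
  have e': "e' > 0" "e' \<le> e" "a + e' < 1"
    using \<open>e > 0\<close> a by (auto simp: e'_def min_def field_simps)
  have "\<forall>\<^sub>F n in sequentially. rel_mset (\<lambda>x y. dist x y < e') (M n) (add_mset 1 L)"
    using lim e'(1) by (simp add: mset_tendsto_def)
  with one show "\<forall>\<^sub>F n in sequentially. dist (Max (insert 0 (cmod ` (set_mset (M n) - {1})))) a < e"
  proof eventually_elim
    case (elim n)
    define M' where "M' = M n - {#1#}"
    have M: "M n = add_mset 1 M'" using elim(1) by (simp add: M'_def)
    obtain N b where N: "add_mset 1 L = add_mset b N" "dist 1 b < e'" "rel_mset (\<lambda>x y. dist x y < e') M' N"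
      using msed_rel_invL[OF elim(2)[unfolded M]] by blast
    have "b = 1"
    proof (rule ccontr)
      assume "b \<noteq> 1"
      then have "b \<in># L" using N(1) by (metis insert_noteq_member)
      then have "cmod b \<le> a" by (rule L(1))
      moreover have "1 - cmod b \<le> dist 1 b"
        using norm_triangle_ineq2[of 1 b] by (simp add: dist_norm)
      ultimately show False using N(2) e'(3) by linarith
    qed
    then have rel: "rel_mset (\<lambda>x y. dist x y < e') M' L" using N by simp
    have upper: "cmod c < a + e'" if "c \<in># M'" for c
    proof -
      obtain d where d: "d \<in># L" "dist c d < e'" using rel_mset_inL[OF rel \<open>c \<in># M'\<close>] .
      have "cmod c - cmod d \<le> dist c d" by (simp add: dist_norm norm_triangle_ineq2)
      then show ?thesis using L(1)[OF d(1)] d(2) by linarith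
    qed
    obtain c where c: "c \<in># M'" "dist c (complex_of_real a) < e'" using rel_mset_inR[OF rel L(2)] .
    have "cmod (complex_of_real a) - cmod c \<le> dist c (complex_of_real a)"
      unfolding dist_norm norm_minus_commute[of c] by (rule norm_triangle_ineq2)
    then have lower: "a - e' < cmod c" using c(2) a(1) by simp
    \<comment> \<open>The eigenvalue 1 is simple in \<open>M n\<close>, so removing the value 1 from
      the set removes exactly the matched copy.\<close>
    have "1 \<notin># M'" using upper[of 1] e'(3) by auto
    then have eq: "set_mset (M n) - {1} = set_mset M'" unfolding M by auto
    have "Max (insert 0 (cmod ` set_mset M')) < a + e'"
      using upper a e'(1) by (subst Max_less_iff) auto
    moreover have "a - e' < Max (insert 0 (cmod ` set_mset M'))"
      using lower c(1) by (subst Max_gr_iff) auto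
    ultimately show ?case
      unfolding eq dist_real_def using e'(2) by linarith
  qed
qed

section \<open>The kernels on words: comparison of spectra and limits\<close>

lemma finite_words: "finite (words k n)"
  unfolding words_def by (intro finite_PiE) auto

lemma finite_carrier_sym_group: "finite (carrier (sym_group k))"
  by (simp add: sym_group_def finite_permutations)

text \<open>For n = 0 the empty word would be fixed by derangements as well; from n = 1 on, an empty
  alphabet admits no words.\<close>

lemma sym_star_eq:
  assumes "n \<ge> 1"
  shows "sym_star k = {g \<in> carrier (sym_group k). invariants (words k n) (word_action k n) g \<noteq> {}}"
proof -
  have "invariants (words k n) (word_action k n) g = {} \<longleftrightarrow> Fix k g = {}" for g
    using assms by (auto simp: invariants_eq_PiE PiE_eq_empty_iff)
  then show ?thesis unfolding sym_star_def by blast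
qed

lemma finite_sym_star: "finite (sym_star k)"
  using finite_carrier_sym_group by (simp add: sym_star_def)

lemma Spec_K_kernel:
  assumes "n \<ge> 1"
  shows "Spec (K_kernel k n) (words k n) - {0} = Spec (Q_kernel k n) (sym_star k) - {0}"
  unfolding K_kernel_def Q_kernel_def
  by (rule Spec_burnside_dual[OF finite_words finite_carrier_sym_group sym_star_eq[OF assms]])

lemma Spec_Q_kernel_nonneg:
  assumes "n \<ge> 1" "c \<in> Spec (Q_kernel k n) (sym_star k)"
  shows "\<exists>r\<ge>0. c = complex_of_real r"
proof (rule Spec_dual_burnside_nonneg[OF finite_words finite_sym_star _ assms(2)[unfolded Q_kernel_def]])
  show "invariants (words k n) (word_action k n) g \<noteq> {}" if "g \<in> sym_star k" for g
    using that sym_star_eq[OF assms(1), of k] by simp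
qed

lemma Spec_K_kernel_nonneg:
  assumes "n \<ge> 1" "c \<in> Spec (K_kernel k n) (words k n)"
  shows "\<exists>r\<ge>0. c = complex_of_real r"
proof (cases "c = 0")
  case True
  then show ?thesis by (intro exI[of _ 0]) simp
next
  case False
  then have "c \<in> Spec (Q_kernel k n) (sym_star k)" using assms Spec_K_kernel by blast
  then show ?thesis by (rule Spec_Q_kernel_nonneg[OF assms(1)])
qed

text \<open>The row of g involves g only through its set of fixed words, which is determined by
  \<open>Fix k g\<close>.\<close>

lemma Spec_Q_kernel:
  assumes "k \<ge> 1"
  shows "Spec (Q_kernel k n) (sym_star k) - {0} = Spec (Q_fs k n) (fs_index k) - {0}"
proof -
  have block: "fs_block k = (\<lambda>S. {g \<in> sym_star k. Fix k g = S})"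
    by (rule ext) (simp add: fs_block_def)
  show ?thesis
    unfolding Q_fs_def block
  proof (rule Spec_lumped_kernel[OF finite_sym_star finite_fs_index])
    show "Fix k ` sym_star k \<subseteq> fs_index k"
      using Fix_in_fs_index assms by blast
    show "Q_kernel k n g h = Q_kernel k n g' h" if "Fix k g = Fix k g'" for g g' h
      unfolding Q_kernel_def dual_burnside_kernel_def invariants_eq_PiE that ..
  qed
qed

text \<open>Row sums are evaluated for \<open>Q_kernel\<close>, where the group action supplies
  them; the eigenvalue 1, being nonzero, then passes to the lumping.\<close>

lemma one_in_Spec_Q_fs:
  assumes "n \<ge> 1" "k \<ge> 1"
  shows "1 \<in> Spec (Q_fs k n) (fs_index k)"
proof -
  have "1 \<in> Spec (Q_kernel k n) (sym_star k)"
  proof (rule one_in_Spec[OF finite_sym_star])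
    have "id \<in> sym_star k"
      using assms(2) by (auto simp: sym_star_def sym_group_def Fix_def)
    then show "sym_star k \<noteq> {}" by blast
  next
    fix g assume "g \<in> sym_star k"
    then show "(\<Sum>h\<in>sym_star k. Q_kernel k n g h) = 1"
      unfolding Q_kernel_def sym_star_eq[OF assms(1)]
      by (intro sum_dual_burnside_kernel[OF word_action_group_action finite_words finite_carrier_sym_group]) auto
  qed
  then have "1 \<in> Spec (Q_kernel k n) (sym_star k) - {0}" by simp
  then show ?thesis unfolding Spec_Q_kernel[OF assms(2)] by blast
qed

lemma lambda_K_Q_kernel:
  assumes "n \<ge> 1"
  shows "lambda1 (K_kernel k n) (words k n) = lambda_star (K_kernel k n) (words k n)"
    and "lambda1 (Q_kernel k n) (sym_star k) = lambda_star (Q_kernel k n) (sym_star k)"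
    and "lambda_star (K_kernel k n) (words k n) = lambda_star (Q_kernel k n) (sym_star k)"
proof -
  show "lambda1 (K_kernel k n) (words k n) = lambda_star (K_kernel k n) (words k n)"
    by (rule lambda1_eq_lambda_star) (rule Spec_K_kernel_nonneg[OF assms])
  show "lambda1 (Q_kernel k n) (sym_star k) = lambda_star (Q_kernel k n) (sym_star k)"
    by (rule lambda1_eq_lambda_star) (rule Spec_Q_kernel_nonneg[OF assms])
  show "lambda_star (K_kernel k n) (words k n) = lambda_star (Q_kernel k n) (sym_star k)"
    by (rule lambda_star_cong) (rule Spec_K_kernel[OF assms])
qed

lemma Spec_mset_Q_fs_tendsto:
  assumes "k \<ge> 3"
  shows "mset_tendsto (\<lambda>n. Spec_mset (Q_fs k n) (fs_index k))
    (\<Sum>r\<in>{1..k-2} \<union> {k}. replicate_mset (k choose r) (complex_of_real (theta k r))) sequentially"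
  unfolding Spec_mset_Q_fs_limit[OF assms, symmetric]
  by (rule Spec_mset_tendsto[OF finite_fs_index Q_fs_tendsto])

lemma lambda_star_K_kernel_tendsto:
  assumes "k \<ge> 3"
  shows "(\<lambda>n. lambda_star (K_kernel k n) (words k n)) \<longlonglongrightarrow> 1 / 2"
proof -
  define L where "L = (\<Sum>r\<in>{1..k-2}. replicate_mset (k choose r) (complex_of_real (theta k r)))"
  have in_L: "c \<in># L \<longleftrightarrow> (\<exists>r\<in>{1..k-2}. c = complex_of_real (theta k r))" for c
    unfolding L_def by (auto simp: set_mset_sum)
  \<comment> \<open>The index r = k contributes the single eigenvalue 1.\<close>
  have "(\<Sum>r\<in>{1..k-2} \<union> {k}. replicate_mset (k choose r) (complex_of_real (theta k r))) = add_mset 1 L"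
    using assms by (subst sum.union_disjoint) (auto simp: L_def theta_self)
  then have "mset_tendsto (\<lambda>n. Spec_mset (Q_fs k n) (fs_index k)) (add_mset 1 L) sequentially"
    using Spec_mset_Q_fs_tendsto[OF assms] by simp
  moreover have "\<forall>\<^sub>F n in sequentially. 1 \<in># Spec_mset (Q_fs k n) (fs_index k)"
    using eventually_ge_at_top[of 1]
    by eventually_elim (use one_in_Spec_Q_fs assms in \<open>simp add: set_Spec_mset\<close>)
  moreover have "cmod c \<le> 1 / 2" if "c \<in># L" for c
  proof -
    from that have "\<exists>r\<in>{1..k-2}. c = complex_of_real (theta k r)" by (simp only: in_L)
    then obtain r where r: "r \<in> {1..k-2}" "c = complex_of_real (theta k r)" ..
    have "0 < theta k r" by (rule theta_pos) (use r(1) assms in auto)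
    moreover have "theta k r \<le> 1 / 2" by (rule theta_le_half) (use r(1) assms in auto)
    ultimately show ?thesis by (simp add: r(2))
  qed
  moreover have "complex_of_real (1 / 2) \<in># L"
  proof -
    have "theta k (k - 2) = 1 / 2" by (rule theta_minus_2) (use assms in simp)
    then have "complex_of_real (1 / 2) = complex_of_real (theta k (k - 2))" by (simp only:)
    moreover have "k - 2 \<in> {1..k-2}" using assms by simp
    ultimately show ?thesis unfolding in_L by (rule bexI)
  qed
  ultimately have "(\<lambda>n. Max (insert 0 (cmod ` (set_mset (Spec_mset (Q_fs k n) (fs_index k)) - {1})))) \<longlonglongrightarrow> 1 / 2"
    by (rule tendsto_Max_nontrivial_spectrum) auto
  then have "(\<lambda>n. lambda_star (Q_fs k n) (fs_index k)) \<longlonglongrightarrow> 1 / 2"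
    by (simp add: set_Spec_mset lambda_star_eq_Max)
  moreover have "\<forall>\<^sub>F n in sequentially.
      lambda_star (Q_fs k n) (fs_index k) = lambda_star (K_kernel k n) (words k n)"
    using eventually_ge_at_top[of 1]
  proof eventually_elim
    case (elim n)
    then show ?case
      using Spec_K_kernel[OF elim, of k] Spec_Q_kernel[of k n] assms by (intro lambda_star_cong) simp
  qed
  ultimately show ?thesis by (rule Lim_transform_eventually)
qed

theorem corollary4p9:
  fixes k :: nat
  assumes "k \<ge> 3"
  shows
    "(\<forall>S \<in> fs_index k. \<forall>T \<in> fs_index k.
        (\<lambda>n. Q_fs k n S T) \<longlonglongrightarrow> Q_fs_limit k S T)
   \<and> (\<forall>Ss. inclusion_ordering k Ss \<longrightarrow>
        upper_triangular (kernel_mat (Q_fs_limit k) Ss) \<and>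
        (\<forall>i < length Ss. kernel_mat (Q_fs_limit k) Ss $$ (i, i) = theta k (card (Ss ! i))))
   \<and> mset_tendsto (\<lambda>n. Spec_mset (Q_fs k n) (fs_index k))
        (\<Sum>r \<in> {1..k-2} \<union> {k}. replicate_mset (k choose r) (complex_of_real (theta k r)))
        sequentially
   \<and> (\<forall>r \<in> {1..k-2} \<union> {k}. theta k r \<noteq> 0)
   \<and> (\<forall>\<^sub>F n in sequentially. invertible_mat (kernel_mat (Q_fs k n) (enum_list (fs_index k))))
   \<and> (\<forall>n \<ge> 1. lambda1 (K_kernel k n) (words k n) = lambda1 (Q_kernel k n) (sym_star k))
   \<and> (\<lambda>n. lambda1 (K_kernel k n) (words k n)) \<longlonglongrightarrow> 1 / 2
   \<and> (\<forall>n \<ge> 1. t_rel (K_kernel k n) (words k n) = t_rel (Q_kernel k n) (sym_star k))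
   \<and> (\<lambda>n. t_rel (K_kernel k n) (words k n)) \<longlonglongrightarrow> 2"
proof -
  have theta: "theta k r \<noteq> 0" if "r \<in> {1..k-2} \<union> {k}" for r
  proof -
    have "k - r \<noteq> 1" using that assms by auto
    then show ?thesis using theta_pos[of k r] by simp
  qed
  then have "0 \<notin># (\<Sum>r\<in>{1..k-2} \<union> {k}. replicate_mset (k choose r) (complex_of_real (theta k r)))"
    by (auto simp: set_mset_sum)
  then have "\<forall>\<^sub>F n in sequentially. 0 \<notin># Spec_mset (Q_fs k n) (fs_index k)"
    by (rule mset_tendsto_eventually_nonzero[OF Spec_mset_Q_fs_tendsto[OF assms]])
  then have inv: "\<forall>\<^sub>F n in sequentially. invertible_mat (kernel_mat (Q_fs k n) (enum_list (fs_index k)))"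
    by eventually_elim (rule invertible_kernel_mat, simp add: set_Spec_mset)
  have "\<forall>\<^sub>F n in sequentially.
      lambda_star (K_kernel k n) (words k n) = lambda1 (K_kernel k n) (words k n)"
    using eventually_ge_at_top[of 1] by eventually_elim (simp add: lambda_K_Q_kernel(1))
  with lambda_star_K_kernel_tendsto[OF assms]
  have lambda1: "(\<lambda>n. lambda1 (K_kernel k n) (words k n)) \<longlonglongrightarrow> 1 / 2"
    by (rule Lim_transform_eventually)
  have "(\<lambda>n. t_rel (K_kernel k n) (words k n)) \<longlonglongrightarrow> inverse (1 - 1 / 2)"
    unfolding t_rel_def by (intro tendsto_intros lambda_star_K_kernel_tendsto assms) simp
  then have t_rel: "(\<lambda>n. t_rel (K_kernel k n) (words k n)) \<longlonglongrightarrow> 2" by simp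
  show ?thesis
  proof (intro conjI ballI allI impI)
    fix n :: nat assume n: "n \<ge> 1"
    show "lambda1 (K_kernel k n) (words k n) = lambda1 (Q_kernel k n) (sym_star k)"
      by (simp only: lambda_K_Q_kernel[OF n])
    show "t_rel (K_kernel k n) (words k n) = t_rel (Q_kernel k n) (sym_star k)"
      by (simp only: t_rel_def lambda_K_Q_kernel[OF n])
  qed (fact Q_fs_tendsto Q_fs_limit_triangular Spec_mset_Q_fs_tendsto[OF assms] theta inv lambda1 t_rel)+
qed

end
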